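(* Let $X \subset \mathbb{R}^n$ be a semi-algebraic set and let $f_1, \ldots, f_r \colon X \rightarrow \mathbb{R}$ be continuous semi-algebraic functions. Then the set $\mathcal{C}(f_1,\ldots,f_r,X)$ of all continuous selections of $\{f_1,\ldots,f_r\}$ on $X$ is finite, and each $f\in \mathcal{C}(f_1,\ldots,f_r,X)$ is a semi-algebraic function.
   Context: A subset of $\mathbb{R}^n$ is semi-algebraic if it is a finite union of sets of the form $\{x : p_1(x)=\cdots=p_k(x)=0,\ p_{k+1}(x)>0,\ldots,p_m(x)>0\}$ with real polynomials $p_i$; a function on a semi-algebraic set is semi-algebraic if its graph is semi-algebraic. A function $f\colon X\to\mathbb{R}$ is a continuous selection of $\{f_1,\ldots,f_r\}$ if $f$ is continuous and $f(x)\in\{f_1(x),\ldots,f_r(x)\}$ for all $x\in X$. $\mathcal{C}(f_1,\ldots,f_r,X)$ denotes the set of all continuous selections of $\{f_1,\ldots,f_r\}$ with domain $X$. *)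

theory Defs
  imports "HOL-Analysis.Analysis" "HOL-Library.FuncSet"
begin

(* real_polynomial_function is the inductive closure of constants and (bounded) linear forms
   under + and *.  On a Euclidean space all linear forms are bounded, so on real ^ 'n these are
   exactly the functions given by real polynomials in n variables.
   Either family of conditions may be empty. *)
definition basic_semialgebraic :: "'a::euclidean_space set \<Rightarrow> bool" where
  "basic_semialgebraic S \<longleftrightarrow>
     (\<exists>P Q. finite P \<and> finite Q \<and>
        (\<forall>p\<in>P \<union> Q. real_polynomial_function p) \<and>
        S = {x. (\<forall>p\<in>P. p x = 0) \<and> (\<forall>q\<in>Q. q x > 0)})"

definition semialgebraic :: "'a::euclidean_space set \<Rightarrow> bool" where
  "semialgebraic S \<longleftrightarrow>
     (\<exists>F. finite F \<and> (\<forall>B\<in>F. basic_semialgebraic B) \<and> S = \<Union>F)"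

(* The graph of a function on a subset of R^n is a subset of R^n x R, which is the rendering of
   R^(n+1) used here.  Only the values on X matter.  The notion is meant for semialgebraic X. *)
definition semialgebraic_fun_on :: "'a::euclidean_space set \<Rightarrow> ('a \<Rightarrow> real) \<Rightarrow> bool" where
  "semialgebraic_fun_on X f \<longleftrightarrow> semialgebraic ((\<lambda>x. (x, f x)) ` X)"

(* The set of continuous selections of f 1, ..., f r with domain X.  A function with domain X is
   represented by the HOL function that is undefined outside X (extensional X), so that distinct
   elements of this set are distinct as functions on X. *)
definition continuous_selections ::
    "nat \<Rightarrow> (nat \<Rightarrow> 'a::topological_space \<Rightarrow> real) \<Rightarrow> 'a set \<Rightarrow> ('a \<Rightarrow> real) set" where
  "continuous_selections r f X =
     {g \<in> extensional X. continuous_on X g \<and> (\<forall>x\<in>X. g x \<in> (\<lambda>i. f i x) ` {1..r})}"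

end

theory Submission
  imports Defs
begin

text \<open>
  A semialgebraic set is a finite union of connected semialgebraic sets, and these can be chosen so
  small that on each of them any two of the \<open>f i\<close> are either equal everywhere or different everywhere.
  On such a piece a continuous selection \<open>g\<close> coincides with a single \<open>f i\<close> by connectedness, so \<open>g\<close> is
  determined by the choice of an index for each piece, and its graph is a finite union of
  restrictions of the graphs of the \<open>f i\<close>.

  Both the decomposition and the theorem of Tarski and Seidenberg (needed for the semialgebraicity of
  \<open>{x \<in> X. f i x < f j x}\<close>) come from a cylindrical decomposition, by recursion on the
  coordinates. All sets live in one fixed Euclidean space: a set or function in fewer variables is a
  cylinder, invariant under translation by the remaining basis vectors. In the recursion step the roots
  of finitely many polynomials in the new variable are arranged into finitely many disjoint graphs of
  continuous functions, following Cohen and Hormander: a polynomial \<open>p\<close> of maximal degree is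
  replaced by its derivative and by its remainders modulo the other polynomials; between consecutive
  roots of the latter \<open>p\<close> is monotone, and at these roots its sign is that of a remainder.
\<close>

section \<open>Real polynomials on an interval\<close>

text \<open>The number of roots between two neighbouring graphs must not change over a cell. Where
  \<open>p\<close> is monotone there is at most one root, and it exists iff \<open>p\<close> takes
  both signs. This is decided at the two ends: by the sign at a bounding graph, or at infinity by
  the positive degree. Monotonicity also yields the continuity of the new root, without an implicit
  function theorem. A root is not a polynomial in the parameters, so the region on either side of
  its graph is not visibly given by sign conditions. Every root function therefore carries this fact
  along, and a new one inherits it from its neighbours. Remainders may multiply the number of
  polynomials, but all of them have smaller degree than \<open>p\<close>; hence a nested induction,
  on the degree bound and on the number of polynomials that may attain it. The degrees have to be
  constant for this, so cells of the smaller space are refined on the way.\<close>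

definition gap :: "real set \<Rightarrow> real set \<Rightarrow> real set" where
  "gap S T = {t. (\<forall>s\<in>S. s < t) \<and> (\<forall>u\<in>T. t < u)}"

lemma open_gap: "finite S \<Longrightarrow> finite T \<Longrightarrow> open (gap S T)"
proof -
  assume "finite S" "finite T"
  moreover have "gap S T = (\<Inter>s\<in>S. {s<..}) \<inter> (\<Inter>u\<in>T. {..<u})"
    by (auto simp: gap_def)
  ultimately show ?thesis by (auto intro!: open_INT)
qed

lemma gap_convex: "a \<in> gap S T \<Longrightarrow> b \<in> gap S T \<Longrightarrow> a \<le> t \<Longrightarrow> t \<le> b \<Longrightarrow> t \<in> gap S T"
  by (force simp: gap_def)

lemma gap_nonempty:
  assumes "finite S" "finite T" "\<And>s u. s \<in> S \<Longrightarrow> u \<in> T \<Longrightarrow> s < u"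
  shows "gap S T \<noteq> {}"
proof (cases "S = {} \<or> T = {}")
  case True
  have "Min (insert 0 T) - 1 < u" if "u \<in> T" for u
  proof -
    have "Min (insert 0 T) \<le> u" using assms(2) that by (intro Min_le) auto
    then show ?thesis by linarith
  qed
  moreover have "s < Max (insert 0 S) + 1" if "s \<in> S" for s
  proof -
    have "s \<le> Max (insert 0 S)" using assms(1) that by (intro Max_ge) auto
    then show ?thesis by linarith
  qed
  ultimately have "\<exists>t. \<forall>u\<in>T. t < u" "\<exists>t. \<forall>s\<in>S. s < t" by blast+
  then show ?thesis using True by (auto simp: gap_def)
next
  case False
  then have "Max S < Min T" using assms by simp
  then obtain t where "Max S < t" "t < Min T" using dense by blast
  then have "t \<in> gap S T" using assms False by (auto simp: gap_def)
  then show ?thesis by blast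
qed

lemma poly_increasing:
  fixes p :: "real poly"
  assumes "\<And>t. a < t \<Longrightarrow> t < b \<Longrightarrow> poly (pderiv p) t > 0" "a < b"
  shows "poly p a < poly p b"
proof -
  from poly_MVT[OF assms(2), of p] obtain x where "a < x" "x < b"
    "poly p b - poly p a = (b - a) * poly (pderiv p) x" by auto
  then show ?thesis using assms(1)[of x] assms(2)
    by (smt (verit) mult_pos_pos)
qed

text \<open>\<open>p\<close> increases from the left end \<open>l\<close> on, so its infimum over
  the gap is its value at \<open>l\<close>. An existential statement about the gap becomes a sign at
  a single point.\<close>

lemma poly_negative_on_gap_iff:
  fixes p :: "real poly"
  assumes "l \<in> S" "\<And>s. s \<in> S \<Longrightarrow> s \<le> l" "gap S T \<noteq> {}"
    and pos: "\<And>t. t \<in> gap S T \<Longrightarrow> poly (pderiv p) t > 0"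
  shows "(\<exists>t\<in>gap S T. poly p t < 0) \<longleftrightarrow> poly p l < 0"
proof -
  have in_gap: "t \<in> gap S T" if "l < t" "t \<le> c" "c \<in> gap S T" for t c
    using assms(1,2) that by (force simp: gap_def)
  show ?thesis
  proof
    assume "\<exists>t\<in>gap S T. poly p t < 0"
    then obtain t where t: "t \<in> gap S T" "poly p t < 0" by blast
    have "l < t" using t assms(1) by (auto simp: gap_def)
    then have "poly p l < poly p t"
      by (intro poly_increasing) (use in_gap[OF _ _ t(1)] pos in auto)
    then show "poly p l < 0" using t by simp
  next
    assume neg: "poly p l < 0"
    obtain c where c: "c \<in> gap S T" using assms(3) by blast
    then have lc: "l < c" using assms(1) by (auto simp: gap_def)
    have "(poly p \<longlongrightarrow> poly p l) (at_right l)"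
      by (intro tendsto_intros)
    then have "\<forall>\<^sub>F t in at_right l. poly p t < 0"
      using neg by (rule order_tendstoD(2))
    moreover have "\<forall>\<^sub>F t in at_right l. t \<in> {l<..<c}"
      using lc by (rule eventually_at_right_real)
    ultimately have "\<forall>\<^sub>F t in at_right l. poly p t < 0 \<and> t \<in> {l<..<c}"
      by (rule eventually_conj)
    then obtain t where "poly p t < 0" "t \<in> {l<..<c}"
      using eventually_happens'[OF trivial_limit_at_right_real] by blast
    then show "\<exists>t\<in>gap S T. poly p t < 0" using in_gap[OF _ _ c] by force
  qed
qed

text \<open>If \<open>p\<close> were nonnegative, then to the left of a point \<open>c\<close> of
  the gap it would stay between 0 and its value at \<open>c\<close>, but a nonconstant polynomial is
  unbounded there.\<close>

lemma poly_negative_on_unbounded_gap: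
  fixes p :: "real poly"
  assumes "gap {} T \<noteq> {}" "degree p > 0"
    and pos: "\<And>t. t \<in> gap {} T \<Longrightarrow> poly (pderiv p) t > 0"
  shows "\<exists>t\<in>gap {} T. poly p t < 0"
proof (rule ccontr)
  assume "\<not> ?thesis"
  then have nonneg: "poly p t \<ge> 0" if "t \<in> gap {} T" for t using that by force
  obtain c where c: "c \<in> gap {} T" using assms(1) by blast
  then have below: "t \<in> gap {} T" if "t \<le> c" for t using that by (force simp: gap_def)
  have "filterlim (poly p) at_infinity at_infinity"
    using assms(2) by (rule filterlim_poly_at_infinity)
  then have "\<forall>\<^sub>F x in at_infinity. norm (poly p x) \<ge> \<bar>poly p c\<bar> + 1"
    by (metis (no_types) filterlim_at_infinity order_refl abs_ge_zero add_nonneg_pos zero_less_one)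
  then obtain r where r: "\<And>x::real. norm x \<ge> r \<Longrightarrow> norm (poly p x) > poly p c"
    unfolding eventually_at_infinity by force
  define t where "t = min (c - 1) (- \<bar>r\<bar>)"
  have t: "t < c" "norm t \<ge> r" by (auto simp: t_def)
  have "poly p t < poly p c"
    by (intro poly_increasing) (use below pos t in auto)
  then show False using r[OF t(2)] nonneg[OF below] t by force
qed

lemma gap_reflect: "t \<in> gap (uminus ` T) (uminus ` S) \<longleftrightarrow> - t \<in> gap S T"
  by (auto simp: gap_def minus_less_iff less_minus_iff)

lemma gap_reflect_nonempty: "gap S T \<noteq> {} \<Longrightarrow> gap (uminus ` T) (uminus ` S) \<noteq> {}"
  using gap_reflect[of _ T S] by (metis all_not_in_conv verit_minus_simplify(4))

text \<open>Point reflection of the graph in the origin. The outer sign keeps increasing polynomials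
  increasing, so statements about the upper end of a gap follow from those about the lower
  end.\<close>

definition reflect :: "real poly \<Rightarrow> real poly" where
  "reflect p = - pcompose p [:0, -1:]"

lemma poly_reflect [simp]: "poly (reflect p) t = - poly p (- t)"
  by (simp add: reflect_def poly_pcompose)

lemma poly_pderiv_reflect [simp]: "poly (pderiv (reflect p)) t = poly (pderiv p) (- t)"
  by (simp add: reflect_def pderiv_minus pderiv_pcompose poly_pcompose pderiv_pCons)

lemma degree_reflect [simp]: "degree (reflect p) = degree p"
  by (simp add: reflect_def degree_pcompose)

lemma poly_positive_on_gap_iff:
  fixes p :: "real poly"
  assumes "l \<in> T" "\<And>s. s \<in> T \<Longrightarrow> l \<le> s" "gap S T \<noteq> {}"
    and pos: "\<And>t. t \<in> gap S T \<Longrightarrow> poly (pderiv p) t > 0"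
  shows "(\<exists>t\<in>gap S T. poly p t > 0) \<longleftrightarrow> poly p l > 0"
proof -
  have "(\<exists>t\<in>gap (uminus ` T) (uminus ` S). poly (reflect p) t < 0) \<longleftrightarrow> poly (reflect p) (- l) < 0"
    using assms by (intro poly_negative_on_gap_iff gap_reflect_nonempty) (auto simp: gap_reflect)
  then show ?thesis
    by (simp add: gap_reflect Bex_def) (metis minus_minus)
qed

lemma poly_positive_on_unbounded_gap:
  fixes p :: "real poly"
  assumes "gap S {} \<noteq> {}" "degree p > 0"
    and pos: "\<And>t. t \<in> gap S {} \<Longrightarrow> poly (pderiv p) t > 0"
  shows "\<exists>t\<in>gap S {}. poly p t > 0"
proof -
  have "\<exists>t\<in>gap {} (uminus ` S). poly (reflect p) t < 0"
    using assms gap_reflect_nonempty[of S "{}"] gap_reflect[of _ "{}" S]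
    by (intro poly_negative_on_unbounded_gap) auto
  then show ?thesis
    using gap_reflect[of _ "{}" S] by auto
qed

text \<open>The gap is open, so a root has points of the gap on both sides, where strict
  monotonicity gives both signs. The converse is the intermediate value theorem.\<close>

lemma poly_root_on_gap_iff:
  fixes p :: "real poly"
  assumes "finite S" "finite T"
    and pos: "\<And>t. t \<in> gap S T \<Longrightarrow> poly (pderiv p) t > 0"
  shows "(\<exists>t\<in>gap S T. poly p t = 0) \<longleftrightarrow> (\<exists>t\<in>gap S T. poly p t < 0) \<and> (\<exists>t\<in>gap S T. poly p t > 0)"
proof safe
  fix t assume t: "t \<in> gap S T" "poly p t = 0"
  obtain e where e: "e > 0" "ball t e \<subseteq> gap S T"
    using open_gap[OF assms(1,2)] t(1) openE by blast
  then have g: "u \<in> gap S T" if "\<bar>u - t\<bar> < e" for u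
    using that by (auto simp: dist_real_def abs_minus_commute subset_iff)
  have "poly p (t - e/2) < poly p t"
    using e by (intro poly_increasing pos g) auto
  moreover have "t - e/2 \<in> gap S T" using e by (intro g) auto
  ultimately show "\<exists>t\<in>gap S T. poly p t < 0" using t by auto
  have "poly p t < poly p (t + e/2)"
    using e by (intro poly_increasing pos g) auto
  moreover have "t + e/2 \<in> gap S T" using e by (intro g) auto
  ultimately show "\<exists>t\<in>gap S T. poly p t > 0" using t by auto
next
  fix a b assume ab: "a \<in> gap S T" "poly p a < 0" "b \<in> gap S T" "poly p b > 0"
  consider "a < b" | "b < a" using ab by force
  then show "\<exists>t\<in>gap S T. poly p t = 0"
  proof cases
    case 1 then show ?thesis using poly_IVT_pos[OF 1 ab(2,4)] gap_convex ab by (meson less_imp_le)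
  next
    case 2 then show ?thesis using poly_IVT_neg[OF 2 ab(4,2)] gap_convex ab by (meson less_imp_le)
  qed
qed

section \<open>Sign classes and connectedness\<close>

lemma degree_eq_if_same_support:
  assumes "\<And>i. coeff p i = 0 \<longleftrightarrow> coeff q i = 0"
  shows "degree p = degree q" "p = 0 \<longleftrightarrow> q = 0"
proof -
  show "degree p = degree q"
    by (intro antisym degree_le allI impI) (use assms coeff_eq_0 in blast)+
  show "p = 0 \<longleftrightarrow> q = 0"
    using assms by (auto simp: poly_eq_iff)
qed

definition same_signs :: "('a \<Rightarrow> real) set \<Rightarrow> 'a \<Rightarrow> 'a \<Rightarrow> bool" where
  "same_signs Q x y \<longleftrightarrow> (\<forall>q\<in>Q. sgn (q x) = sgn (q y))"

lemma same_signs_sym: "same_signs Q x y \<Longrightarrow> same_signs Q y x"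
  by (simp add: same_signs_def)

lemma same_signs_mono: "same_signs Q x y \<Longrightarrow> Q' \<subseteq> Q \<Longrightarrow> same_signs Q' x y"
  by (auto simp: same_signs_def)

text \<open>For the ring of all polynomials this is semialgebraicity, in a form that is closed under Boolean
  operations by construction.\<close>

definition sa_over :: "('a \<Rightarrow> real) set \<Rightarrow> 'a set \<Rightarrow> bool" where
  "sa_over R S \<longleftrightarrow> (\<exists>Q. finite Q \<and> Q \<subseteq> R \<and> (\<forall>x y. same_signs Q x y \<longrightarrow> x \<in> S \<longrightarrow> y \<in> S))"

lemma sa_over_mono: "sa_over R S \<Longrightarrow> R \<subseteq> R' \<Longrightarrow> sa_over R' S"
  unfolding sa_over_def by blast

lemma sa_over_UNIV [intro, simp]: "sa_over R UNIV"
  unfolding sa_over_def by blast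

lemma sa_over_pos: "q \<in> R \<Longrightarrow> sa_over R {x. q x > 0}"
  unfolding sa_over_def
proof (intro exI[of _ "{q}"] conjI allI impI)
  fix x y assume "same_signs {q} x y" "x \<in> {x. q x > 0}"
  then show "y \<in> {x. q x > 0}" by (simp add: same_signs_def) (metis sgn_1_pos)
qed auto

lemma sa_over_Compl:
  assumes "sa_over R S" shows "sa_over R (- S)"
proof -
  obtain Q where "finite Q" "Q \<subseteq> R" "\<And>x y. same_signs Q x y \<Longrightarrow> x \<in> S \<Longrightarrow> y \<in> S"
    using assms unfolding sa_over_def by blast
  then show ?thesis unfolding sa_over_def using same_signs_sym by (metis Compl_iff)
qed

lemma sa_over_INT:
  assumes "finite I" "\<And>i. i \<in> I \<Longrightarrow> sa_over R (S i)"
  shows "sa_over R (\<Inter>i\<in>I. S i)"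
proof -
  have "\<forall>i\<in>I. \<exists>Q. finite Q \<and> Q \<subseteq> R \<and> (\<forall>x y. same_signs Q x y \<longrightarrow> x \<in> S i \<longrightarrow> y \<in> S i)"
    using assms(2) by (simp add: sa_over_def)
  then obtain Q where Q: "\<forall>i\<in>I. finite (Q i) \<and> Q i \<subseteq> R \<and> (\<forall>x y. same_signs (Q i) x y \<longrightarrow> x \<in> S i \<longrightarrow> y \<in> S i)"
    by (rule bchoice[THEN exE])
  have "\<forall>x y. same_signs (\<Union>i\<in>I. Q i) x y \<longrightarrow> x \<in> (\<Inter>i\<in>I. S i) \<longrightarrow> y \<in> (\<Inter>i\<in>I. S i)"
  proof (intro allI impI INT_I)
    fix x y i assume xy: "same_signs (\<Union>i\<in>I. Q i) x y" "x \<in> (\<Inter>i\<in>I. S i)" "i \<in> I"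
    then have "same_signs (Q i) x y" by (auto simp: same_signs_def)
    then show "y \<in> S i" using Q xy by blast
  qed
  then show ?thesis unfolding sa_over_def
    using Q assms(1) by (intro exI[of _ "\<Union>i\<in>I. Q i"]) auto
qed

lemma sa_over_UN:
  assumes "finite I" "\<And>i. i \<in> I \<Longrightarrow> sa_over R (S i)"
  shows "sa_over R (\<Union>i\<in>I. S i)"
  using sa_over_Compl[OF sa_over_INT[OF assms(1), of R "\<lambda>i. - S i"]] assms(2) sa_over_Compl
  by fastforce

lemma sa_over_Un: "sa_over R S \<Longrightarrow> sa_over R T \<Longrightarrow> sa_over R (S \<union> T)"
  using sa_over_UN[of "{S, T}" R id] by auto

lemma sa_over_Int: "sa_over R S \<Longrightarrow> sa_over R T \<Longrightarrow> sa_over R (S \<inter> T)"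
  using sa_over_INT[of "{S, T}" R id] by auto

lemma sa_over_Diff: "sa_over R S \<Longrightarrow> sa_over R T \<Longrightarrow> sa_over R (S - T)"
  by (simp add: Diff_eq sa_over_Int sa_over_Compl)

text \<open>The invariant of the recursion on the coordinates. The cells may overlap. As they are
  defined by signs of functions in \<open>R\<close> themselves, these functions can be added to a
  family \<open>Q\<close> when a cell has to be refined.\<close>

definition cell_dec :: "('a::topological_space \<Rightarrow> real) set \<Rightarrow> bool" where
  "cell_dec R \<longleftrightarrow> (\<forall>Q. finite Q \<longrightarrow> Q \<subseteq> R \<longrightarrow>
     (\<exists>\<A>. finite \<A> \<and> \<Union>\<A> = UNIV \<and>
        (\<forall>A\<in>\<A>. connected A \<and> A \<noteq> {} \<and> sa_over R A \<and> (\<forall>x\<in>A. \<forall>y\<in>A. same_signs Q x y))))"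

lemma connected_locally_constant:
  assumes "connected A" "x \<in> A" "y \<in> A" 
    and "openin (top_of_set A) {z \<in> A. P z}" "openin (top_of_set A) {z \<in> A. \<not> P z}"
    and "P x"
  shows "P y"
proof (rule ccontr)
  assume "\<not> P y"
  then have "{z \<in> A. P z} \<noteq> {}" "{z \<in> A. \<not> P z} \<noteq> {}" "{z \<in> A. P z} \<inter> {z \<in> A. \<not> P z} = {}"
    "A \<subseteq> {z \<in> A. P z} \<union> {z \<in> A. \<not> P z}"
    using assms(2,3,6) by auto
  then show False using assms(1,4,5) unfolding connected_openin by metis
qed

lemma connected_sgn_constant:
  fixes f :: "'a::topological_space \<Rightarrow> real"
  assumes "connected A" "continuous_on A f" "\<And>x. x \<in> A \<Longrightarrow> f x \<noteq> 0" "x \<in> A" "y \<in> A"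
  shows "sgn (f x) = sgn (f y)"
proof -
  have conn: "connected (f ` A)" using assms connected_continuous_image by blast
  have "f y > 0" if "f x > 0" "x \<in> A" "y \<in> A" for x y
  proof (rule ccontr)
    assume "\<not> f y > 0"
    then have "0 \<in> f ` A" using connectedD_interval[OF conn, of "f y" "f x" 0] that by auto
    then show False using assms(3) by auto
  qed
  then show ?thesis using assms(3-5) by (metis linorder_neqE sgn_pos sgn_neg)
qed

text \<open>The saturation of \<open>E\<close> along \<open>b\<close> is a union of translates of
  \<open>E\<close>: this is the openness of the projection.\<close>

lemma translate_openin:
  fixes b :: "'a::real_normed_vector"
  assumes "\<And>x s. x \<in> A \<Longrightarrow> x + s *\<^sub>R b \<in> A" "openin (top_of_set A) E"
  shows "openin (top_of_set A) {x \<in> A. \<exists>s. x + s *\<^sub>R b \<in> E}"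
proof -
  have "openin (top_of_set A) (A \<inter> (\<lambda>x. x + s *\<^sub>R b) -` E)" for s
    by (rule continuous_openin_preimage[OF _ _ assms(2)]) (use assms(1) in \<open>auto intro!: continuous_intros\<close>)
  then have "openin (top_of_set A) (\<Union>s. A \<inter> (\<lambda>x. x + s *\<^sub>R b) -` E)" by blast
  moreover have "{x \<in> A. \<exists>s. x + s *\<^sub>R b \<in> E} = (\<Union>s. A \<inter> (\<lambda>x. x + s *\<^sub>R b) -` E)" by auto
  ultimately show ?thesis by simp
qed

text \<open>Projection along \<open>b\<close> is an open map, so a separation of \<open>W\<close> would project to a separation of \<open>A\<close>.\<close>

lemma connected_if_connected_fibres:
  fixes b :: "'a::real_normed_vector"
  assumes A: "connected A" "\<And>x s. x \<in> A \<Longrightarrow> x + s *\<^sub>R b \<in> A"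
    and W: "openin (top_of_set A) W" 
    and ne: "\<And>x. x \<in> A \<Longrightarrow> \<exists>s. x + s *\<^sub>R b \<in> W"
    and fib: "\<And>x. x \<in> A \<Longrightarrow> connected {s. x + s *\<^sub>R b \<in> W}"
  shows "connected W"
proof (rule ccontr)
  assume "\<not> connected W"
  then obtain E1 E2 where E: "openin (top_of_set W) E1" "openin (top_of_set W) E2"
     "W \<subseteq> E1 \<union> E2" "E1 \<inter> E2 = {}" "E1 \<noteq> {}" "E2 \<noteq> {}"
    unfolding connected_openin by blast
  have W_A: "W \<subseteq> A" using W openin_imp_subset by blast
  have E_W: "E1 \<subseteq> W" "E2 \<subseteq> W" using E openin_imp_subset by blast+
  have op: "openin (top_of_set A) E1" "openin (top_of_set A) E2"
    using E(1,2) W openin_trans by blast+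
  let ?F = "\<lambda>E. {x \<in> A. \<exists>s. x + s *\<^sub>R b \<in> E}"
  \<comment> \<open>A line in direction \<open>b\<close> that meets both parts would have its trace
    on \<open>W\<close> separated by them, against the connectedness of the fibres.\<close>
  have "?F E1 \<inter> ?F E2 = {}"
  proof (rule ccontr)
    assume "?F E1 \<inter> ?F E2 \<noteq> {}"
    then obtain x s1 s2 where x: "x \<in> A" "x + s1 *\<^sub>R b \<in> E1" "x + s2 *\<^sub>R b \<in> E2" by blast
    let ?S = "{s. x + s *\<^sub>R b \<in> W}"
    have "openin (top_of_set ?S) (?S \<inter> (\<lambda>s. x + s *\<^sub>R b) -` E1)"
      by (rule continuous_openin_preimage[OF _ _ E(1)]) (auto intro!: continuous_intros)
    moreover have "openin (top_of_set ?S) (?S \<inter> (\<lambda>s. x + s *\<^sub>R b) -` E2)"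
      by (rule continuous_openin_preimage[OF _ _ E(2)]) (auto intro!: continuous_intros)
    moreover have "?S \<inter> (\<lambda>s. x + s *\<^sub>R b) -` E1 \<noteq> {}" "?S \<inter> (\<lambda>s. x + s *\<^sub>R b) -` E2 \<noteq> {}"
      using x E_W by auto
    moreover have "?S \<subseteq> (?S \<inter> (\<lambda>s. x + s *\<^sub>R b) -` E1) \<union> (?S \<inter> (\<lambda>s. x + s *\<^sub>R b) -` E2)"
      using E(3) by auto
    moreover have "(?S \<inter> (\<lambda>s. x + s *\<^sub>R b) -` E1) \<inter> (?S \<inter> (\<lambda>s. x + s *\<^sub>R b) -` E2) = {}"
      using E(4) by auto
    ultimately show False
      using fib[OF x(1)] unfolding connected_openin by metis
  qed
  moreover have "?F E1 \<noteq> {}" "?F E2 \<noteq> {}"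
  proof -
    have "E \<subseteq> ?F E" if "E \<subseteq> W" for E
      using that W_A by (auto intro!: exI[of _ 0])
    from this[OF E_W(1)] this[OF E_W(2)] show "?F E1 \<noteq> {}" "?F E2 \<noteq> {}"
      using E(5,6) by (metis subset_empty)+
  qed
  moreover have "A \<subseteq> ?F E1 \<union> ?F E2" using ne E(3) by blast
  moreover have "openin (top_of_set A) (?F E1)" "openin (top_of_set A) (?F E2)"
    using translate_openin[OF A(2)] op by blast+
  ultimately have "\<not> connected A"
    unfolding connected_openin not_not by (intro exI[of _ "?F E1"] exI[of _ "?F E2"] conjI)
  then show False using A(1) by contradiction
qed

section \<open>Adjoining a variable\<close>

text \<open>The coefficients are functions on the whole space, so a polynomial over \<open>R\<close>
  is a map into \<open>real poly\<close>. The uniform degree bound makes it a single polynomial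
  rather than a family of unbounded degree.\<close>

definition adjoin :: "'a::real_inner \<Rightarrow> ('a \<Rightarrow> real) set \<Rightarrow> ('a \<Rightarrow> real) set" where
  "adjoin b R = {\<lambda>x. poly (P x) (x \<bullet> b) |P.
     (\<forall>i. (\<lambda>x. coeff (P x) i) \<in> R) \<and> (\<exists>N. \<forall>x. degree (P x) \<le> N)}"

lemma adjoinI:
  assumes "\<And>i. (\<lambda>x. coeff (P x) i) \<in> R" "\<And>x. degree (P x) \<le> N"
    and "\<And>x. f x = poly (P x) (x \<bullet> b)"
  shows "f \<in> adjoin b R"
  using assms unfolding adjoin_def by (auto simp: fun_eq_iff)

lemma adjoinE:
  assumes "f \<in> adjoin b R"
  obtains P N where "\<And>i. (\<lambda>x. coeff (P x) i) \<in> R" "\<And>x. degree (P x) \<le> N"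
    "\<And>x. f x = poly (P x) (x \<bullet> b)"
  using assms unfolding adjoin_def by auto

locale function_ring =
  fixes R :: "('a \<Rightarrow> real) set"
  assumes const: "(\<lambda>_. c) \<in> R"
    and add: "f \<in> R \<Longrightarrow> g \<in> R \<Longrightarrow> (\<lambda>x. f x + g x) \<in> R"
    and mult: "f \<in> R \<Longrightarrow> g \<in> R \<Longrightarrow> (\<lambda>x. f x * g x) \<in> R"
begin

lemma uminus: "f \<in> R \<Longrightarrow> (\<lambda>x. - f x) \<in> R"
  using mult[OF const[of "- 1"], of f] by simp

lemma diff: "f \<in> R \<Longrightarrow> g \<in> R \<Longrightarrow> (\<lambda>x. f x - g x) \<in> R"
  using add[of f "\<lambda>x. - g x"] uminus by simp

lemma sum: "finite I \<Longrightarrow> (\<And>i. i \<in> I \<Longrightarrow> f i \<in> R) \<Longrightarrow> (\<lambda>x. \<Sum>i\<in>I. f i x) \<in> R"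
  by (induction I rule: finite_induct) (auto intro: const add)

end

lemma subset_adjoin:
  fixes R :: "('a::real_inner \<Rightarrow> real) set"
  assumes "function_ring R"
  shows "R \<subseteq> adjoin b R"
proof
  interpret function_ring R by fact
  fix f assume f: "f \<in> R"
  show "f \<in> adjoin b R"
  proof (rule adjoinI[where P = "\<lambda>x. [:f x:]" and N = 0])
    show "(\<lambda>x. coeff [:f x:] i) \<in> R" for i using f const[of 0] by (cases i) auto
  qed auto
qed

lemma coordinate_in_adjoin:
  fixes R :: "('a::real_inner \<Rightarrow> real) set"
  assumes "function_ring R"
  shows "(\<lambda>x. x \<bullet> b) \<in> adjoin b R"
proof -
  interpret function_ring R by fact
  show ?thesis
    by (rule adjoinI[where P = "\<lambda>x. [:0, 1:]" and N = 1]) (auto intro: const)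
qed

lemma function_ring_adjoin:
  fixes R :: "('a::real_inner \<Rightarrow> real) set"
  assumes "function_ring R"
  shows "function_ring (adjoin b R)"
proof
  interpret function_ring R by fact
  show "(\<lambda>_. c) \<in> adjoin b R" for c
    using subset_adjoin[OF assms] const by blast
  fix f g assume fg: "f \<in> adjoin b R" "g \<in> adjoin b R"
  obtain P M where P: "\<And>i. (\<lambda>x. coeff (P x) i) \<in> R" "\<And>x. degree (P x) \<le> M"
      "\<And>x. f x = poly (P x) (x \<bullet> b)"
    using adjoinE[OF fg(1)] by blast
  obtain Q N where Q: "\<And>i. (\<lambda>x. coeff (Q x) i) \<in> R" "\<And>x. degree (Q x) \<le> N"
      "\<And>x. g x = poly (Q x) (x \<bullet> b)"
    using adjoinE[OF fg(2)] by blast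
  show "(\<lambda>x. f x + g x) \<in> adjoin b R"
  proof (rule adjoinI[where P = "\<lambda>x. P x + Q x" and N = "M + N"])
    show "degree (P x + Q x) \<le> M + N" for x
      using P(2)[of x] Q(2)[of x] by (intro degree_add_le) auto
  qed (use P Q in \<open>auto intro: add\<close>)
  show "(\<lambda>x. f x * g x) \<in> adjoin b R"
  proof (rule adjoinI[where P = "\<lambda>x. P x * Q x" and N = "M + N"])
    show "(\<lambda>x. coeff (P x * Q x) i) \<in> R" for i
      unfolding coeff_mult using P Q by (auto intro!: sum mult)
    show "degree (P x * Q x) \<le> M + N" for x
      using degree_mult_le[of "P x" "Q x"] P(2)[of x] Q(2)[of x] by linarith
  qed (use P Q in auto)
qed

text \<open>One step of the recursion. By \<open>inv\<close> the functions in \<open>R\<close>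
  depend on the other variables only, by \<open>unit\<close> the new variable is
  \<open>x \<bullet> b\<close>, and \<open>dec\<close> is the induction hypothesis.\<close>

locale poly_extension = function_ring R for R :: "('a::euclidean_space \<Rightarrow> real) set" +
  fixes b :: 'a
  assumes cont: "f \<in> R \<Longrightarrow> continuous_on UNIV f"
    and inv: "f \<in> R \<Longrightarrow> f (x + s *\<^sub>R b) = f x"
    and unit: "b \<bullet> b = 1"
    and dec: "cell_dec R"
begin

abbreviation "R' \<equiv> adjoin b R"

definition cell :: "'a set \<Rightarrow> bool" where
  "cell A \<longleftrightarrow> connected A \<and> A \<noteq> {} \<and> sa_over R A"

text \<open>Off \<open>A\<close> nothing is required: remainders are polynomial in the coefficients only where the degree of
  the divisor is constant.\<close>

definition pfun :: "'a set \<Rightarrow> nat \<Rightarrow> ('a \<Rightarrow> real poly) \<Rightarrow> bool" where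
  "pfun A N P \<longleftrightarrow> (\<forall>i. \<exists>q\<in>R. \<forall>x\<in>A. coeff (P x) i = q x) \<and> (\<forall>x\<in>A. degree (P x) \<le> N)"

definition lift :: "'a \<Rightarrow> real \<Rightarrow> 'a" where
  "lift x t = x + (t - x \<bullet> b) *\<^sub>R b"

lemma lift_inner [simp]: "lift x t \<bullet> b = t"
  by (simp add: lift_def inner_add_left unit)

lemma shift_inner [simp]: "(x + s *\<^sub>R b) \<bullet> b = x \<bullet> b + s"
  by (simp add: inner_add_left unit)

text \<open>Sign conditions on functions that are constant along \<open>b\<close> cut out
  cylinders.\<close>

lemma sa_R_translate: "sa_over R A \<Longrightarrow> x \<in> A \<Longrightarrow> x + s *\<^sub>R b \<in> A"
proof -
  assume A: "sa_over R A" "x \<in> A"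
  then obtain Q where Q: "Q \<subseteq> R" "\<And>x y. same_signs Q x y \<Longrightarrow> x \<in> A \<Longrightarrow> y \<in> A"
    unfolding sa_over_def by blast
  have "same_signs Q x (x + s *\<^sub>R b)"
    unfolding same_signs_def using Q(1) inv[of _ x s] by (metis subsetD)
  then show ?thesis using Q A by blast
qed

lemma cell_translate: "cell A \<Longrightarrow> x \<in> A \<Longrightarrow> x + s *\<^sub>R b \<in> A"
  using sa_R_translate by (simp add: cell_def)

lemma cell_lift: "cell A \<Longrightarrow> x \<in> A \<Longrightarrow> lift x t \<in> A"
  using cell_translate by (simp add: lift_def)

lemma cell_UNIV: "cell UNIV"
  by (simp add: cell_def convex_connected)

text \<open>Decompose the whole space for \<open>Q\<close> together with the functions
  \<open>Q'\<close> that define \<open>A\<close>. A cell on which the signs of \<open>Q'\<close> are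
  constant lies inside \<open>A\<close> as soon as it meets it.\<close>

lemma cell_refine:
  assumes "cell A" "finite Q" "Q \<subseteq> R"
  obtains \<A> where "finite \<A>" "\<Union>\<A> = A"
    "\<And>A'. A' \<in> \<A> \<Longrightarrow> cell A' \<and> A' \<subseteq> A \<and> (\<forall>x\<in>A'. \<forall>y\<in>A'. same_signs Q x y)"
proof -
  obtain Q' where Q': "finite Q'" "Q' \<subseteq> R" "\<And>x y. same_signs Q' x y \<Longrightarrow> x \<in> A \<Longrightarrow> y \<in> A"
    using assms(1) unfolding cell_def sa_over_def by blast
  have "finite (Q \<union> Q')" "Q \<union> Q' \<subseteq> R" using assms Q' by auto
  then obtain \<A> where \<A>: "finite \<A>" "\<Union>\<A> = UNIV" 
     "\<And>A. A \<in> \<A> \<Longrightarrow> connected A \<and> A \<noteq> {} \<and> sa_over R A \<and> (\<forall>x\<in>A. \<forall>y\<in>A. same_signs (Q \<union> Q') x y)"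
    using dec unfolding cell_dec_def by metis
  have sub: "B \<subseteq> A" if "B \<in> \<A>" "B \<inter> A \<noteq> {}" for B
  proof
    fix y assume "y \<in> B"
    moreover obtain x where "x \<in> B" "x \<in> A" using \<open>B \<inter> A \<noteq> {}\<close> by blast
    ultimately show "y \<in> A" using \<A>(3)[OF that(1)] Q'(3) same_signs_mono[of _ x y Q'] by (meson Un_upper2)
  qed
  show ?thesis
  proof (rule that[of "{B \<in> \<A>. B \<inter> A \<noteq> {}}"])
    show "\<Union>{B \<in> \<A>. B \<inter> A \<noteq> {}} = A"
    proof
      show "A \<subseteq> \<Union>{B \<in> \<A>. B \<inter> A \<noteq> {}}"
      proof
        fix x assume "x \<in> A"
        moreover obtain B where "B \<in> \<A>" "x \<in> B" using \<A>(2) by blast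
        ultimately show "x \<in> \<Union>{B \<in> \<A>. B \<inter> A \<noteq> {}}" by blast
      qed
    qed (use sub in blast)
    fix A' assume A': "A' \<in> {B \<in> \<A>. B \<inter> A \<noteq> {}}"
    then show "cell A' \<and> A' \<subseteq> A \<and> (\<forall>x\<in>A'. \<forall>y\<in>A'. same_signs Q x y)"
      using \<A>(3)[of A'] sub[of A'] same_signs_mono[of "Q \<union> Q'" _ _ Q] unfolding cell_def by auto
  qed (use \<A> in auto)
qed

lemma pfun_mono: "pfun A N P \<Longrightarrow> A' \<subseteq> A \<Longrightarrow> N \<le> N' \<Longrightarrow> pfun A' N' P"
  unfolding pfun_def by (meson order_trans subsetD)

text \<open>Off \<open>A\<close> the polynomials are arbitrary, so a member of \<open>R'\<close> is
  rebuilt from globally defined coefficient functions, cut off at the degree bound.\<close>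

lemma pfun_agree:
  assumes "pfun A N P"
  obtains q where "q \<in> R'" "\<And>x. x \<in> A \<Longrightarrow> poly (P x) (x \<bullet> b) = q x"
proof -
  have "\<forall>i. \<exists>q. q \<in> R \<and> (\<forall>x\<in>A. coeff (P x) i = q x)" using assms unfolding pfun_def by blast
  then obtain c where c: "\<And>i. c i \<in> R" "\<And>i x. x \<in> A \<Longrightarrow> coeff (P x) i = c i x" by metis
  define P' where "P' x = (\<Sum>i\<le>N. monom (c i x) i)" for x
  have coeff_P': "coeff (P' x) i = (if i \<le> N then c i x else 0)" for x i
    by (simp add: P'_def coeff_sum)
  show ?thesis
  proof (rule that[of "\<lambda>x. poly (P' x) (x \<bullet> b)"])
    show "(\<lambda>x. poly (P' x) (x \<bullet> b)) \<in> R'"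
    proof (rule adjoinI[where P = P' and N = N])
      show "(\<lambda>x. coeff (P' x) i) \<in> R" for i
        using c(1) const[of 0] by (cases "i \<le> N") (auto simp: coeff_P')
      show "degree (P' x) \<le> N" for x
        by (rule degree_le) (simp add: coeff_P')
    qed simp
    fix x assume "x \<in> A"
    then have "P x = P' x"
      using assms c(2)[symmetric] by (intro poly_eqI) (auto simp: coeff_P' pfun_def coeff_eq_0)
    then show "poly (P x) (x \<bullet> b) = poly (P' x) (x \<bullet> b)" by simp
  qed
qed

lemma pfun_continuous:
  assumes "pfun A N P" "continuous_on A g"
  shows "continuous_on A (\<lambda>x. poly (P x) (g x))"
proof -
  have "continuous_on A (\<lambda>x. coeff (P x) i)" for i
  proof -
    obtain q where "q \<in> R" "\<forall>x\<in>A. coeff (P x) i = q x" using assms unfolding pfun_def by blast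
    then show ?thesis using cont[of q] continuous_on_subset[of UNIV q A] by (simp cong: continuous_on_cong)
  qed
  then have "continuous_on A (\<lambda>x. \<Sum>i\<le>N. coeff (P x) i * g x ^ i)"
    by (intro continuous_intros assms(2))
  moreover have "poly (P x) (g x) = (\<Sum>i\<le>N. coeff (P x) i * g x ^ i)" if "x \<in> A" for x
  proof -
    have "P x = (\<Sum>i\<le>N. monom (coeff (P x) i) i)"
      using assms that by (simp add: pfun_def poly_as_sum_of_monoms')
    then have "poly (P x) (g x) = poly (\<Sum>i\<le>N. monom (coeff (P x) i) i) (g x)" by simp
    then show ?thesis by (simp add: poly_sum poly_monom)
  qed
  ultimately show ?thesis by (simp cong: continuous_on_cong)
qed

lemma pfun_shift:
  assumes "pfun A N P" "cell A" "x \<in> A"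
  shows "P (x + s *\<^sub>R b) = P x"
proof (rule poly_eqI)
  fix i
  obtain q where "q \<in> R" "\<forall>x\<in>A. coeff (P x) i = q x" using assms unfolding pfun_def by blast
  then show "coeff (P (x + s *\<^sub>R b)) i = coeff (P x) i"
    using inv assms cell_translate by simp
qed

lemma pfun_pderiv: "pfun A N P \<Longrightarrow> pfun A (N - 1) (\<lambda>x. pderiv (P x))"
  unfolding pfun_def
proof (intro conjI allI ballI)
  fix i assume P: "(\<forall>i. \<exists>q\<in>R. \<forall>x\<in>A. coeff (P x) i = q x) \<and> (\<forall>x\<in>A. degree (P x) \<le> N)"
  then obtain q where "q \<in> R" "\<forall>x\<in>A. coeff (P x) (Suc i) = q x" by blast
  then show "\<exists>q\<in>R. \<forall>x\<in>A. coeff (pderiv (P x)) i = q x"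
    by (intro bexI[of _ "\<lambda>x. of_nat (Suc i) * q x"]) (auto simp: coeff_pderiv intro: mult const)
next
  fix x assume "(\<forall>i. \<exists>q\<in>R. \<forall>x\<in>A. coeff (P x) i = q x) \<and> (\<forall>x\<in>A. degree (P x) \<le> N)" "x \<in> A"
  then show "degree (pderiv (P x)) \<le> N - 1" by (simp add: degree_pderiv diff_le_mono)
qed

lemma pfun_smult: "pfun A N P \<Longrightarrow> pfun A N (\<lambda>x. smult c (P x))"
  unfolding pfun_def
proof (intro conjI allI ballI)
  fix i assume P: "(\<forall>i. \<exists>q\<in>R. \<forall>x\<in>A. coeff (P x) i = q x) \<and> (\<forall>x\<in>A. degree (P x) \<le> N)"
  then obtain q where "q \<in> R" "\<forall>x\<in>A. coeff (P x) i = q x" by blast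
  then show "\<exists>q\<in>R. \<forall>x\<in>A. coeff (smult c (P x)) i = q x"
    by (intro bexI[of _ "\<lambda>x. c * q x"]) (auto intro: mult const)
qed (auto intro: order_trans[OF degree_smult_le])

text \<open>One step of pseudo-division multiplies by the square of the leading coefficient of \<open>q\<close>, so that
  signs at the roots of \<open>q\<close> are preserved.\<close>

lemma pseudo_remainder:
  assumes q: "pfun A N q" "\<And>x. x \<in> A \<Longrightarrow> degree (q x) = m" and m: "m > 0"
    and P: "pfun A n P"
  shows "\<exists>r. pfun A (m - 1) r \<and> (\<forall>x\<in>A. \<forall>t. poly (q x) t = 0 \<longrightarrow> sgn (poly (r x) t) = sgn (poly (P x) t))"
  using P
proof (induction n arbitrary: P)
  case 0
  then show ?case using pfun_mono[OF 0 order_refl, of "m - 1"] by auto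
next
  case (Suc n)
  show ?case
  proof (cases "Suc n < m")
    case True
    then have "pfun A (m - 1) P" by (intro pfun_mono[OF Suc.prems order_refl]) simp
    then show ?thesis by blast
  next
    case False
    define k where "k = Suc n - m"
    define c where "c x = coeff (q x) m" for x
    define P1 where "P1 x = smult (c x ^ 2) (P x) - monom (c x * coeff (P x) (Suc n)) k * q x" for x
    \<comment> \<open>The terms of degree \<open>Suc n\<close> cancel, even where
      \<open>coeff (P x) (Suc n)\<close> vanishes. Nothing is divided, so one formula in the
      coefficients serves for all points of \<open>A\<close>.\<close>
    have coeff_P1: "coeff (P1 x) i = c x ^ 2 * coeff (P x) i
        - (if i < k then 0 else c x * coeff (P x) (Suc n) * coeff (q x) (i - k))" for x i
      by (simp add: P1_def coeff_monom_mult)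
    have "pfun A n P1"
      unfolding pfun_def
    proof (intro conjI allI ballI)
      fix i
      have "\<exists>f\<in>R. \<forall>x\<in>A. coeff (P x) j = f x" "\<exists>f\<in>R. \<forall>x\<in>A. coeff (q x) j = f x" for j
        using q Suc.prems by (auto simp: pfun_def)
      then obtain f1 f2 f3 f4 where f: "f1 \<in> R" "\<forall>x\<in>A. coeff (q x) m = f1 x" 
          "f2 \<in> R" "\<forall>x\<in>A. coeff (P x) (Suc n) = f2 x"
          "f3 \<in> R" "\<forall>x\<in>A. coeff (P x) i = f3 x"
          "f4 \<in> R" "\<forall>x\<in>A. coeff (q x) (i - k) = f4 x" by metis
      have "(\<lambda>x. f1 x * f1 x * f3 x - (if i < k then 0 else f1 x * f2 x * f4 x)) \<in> R"
        using f by (cases "i < k") (auto intro!: mult diff const)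
      then show "\<exists>q\<in>R. \<forall>x\<in>A. coeff (P1 x) i = q x"
        by (rule bexI[rotated]) (use f in \<open>auto simp: coeff_P1 c_def power2_eq_square\<close>)
    next
      fix x assume x: "x \<in> A"
      show "degree (P1 x) \<le> n"
      proof (rule degree_le, intro allI impI)
        fix i assume i: "n < i"
        show "coeff (P1 x) i = 0"
        proof (cases "i = Suc n")
          case True
          then show ?thesis using False by (simp add: coeff_P1 k_def c_def power2_eq_square)
        next
          case False
          then have "i > Suc n" using i by simp
          moreover have "degree (P x) \<le> Suc n" using Suc.prems x by (simp add: pfun_def)
          moreover have "i - k > m" using \<open>i > Suc n\<close> \<open>\<not> Suc n < m\<close> by (simp add: k_def)
          ultimately show ?thesis using q(2)[OF x] by (simp add: coeff_P1 coeff_eq_0)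
        qed
      qed
    qed
    from Suc.IH[OF this] obtain r where r: "pfun A (m - 1) r"
      "\<And>x t. x \<in> A \<Longrightarrow> poly (q x) t = 0 \<Longrightarrow> sgn (poly (r x) t) = sgn (poly (P1 x) t)" by blast
    have "sgn (poly (P1 x) t) = sgn (poly (P x) t)" if "x \<in> A" "poly (q x) t = 0" for x t
    proof -
      have "c x \<noteq> 0" using q(2)[OF that(1)] m by (metis c_def degree_0 leading_coeff_0_iff less_irrefl)
      then have "sgn (c x ^ 2) = 1" by (intro sgn_pos) simp
      then show ?thesis using that by (simp add: P1_def poly_monom sgn_mult)
    qed
    then show ?thesis using r by (intro exI[of _ r]) simp
  qed
qed

section \<open>Arranging roots into graphs\<close>

text \<open>\<xi> need not be polynomial, so the two strict sides of its graph are required to be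
  definable. The graph over \<open>A\<close> is then definable too, as what remains of
  \<open>A\<close> without them.\<close>

definition root_fun :: "'a set \<Rightarrow> ('a \<Rightarrow> real) \<Rightarrow> bool" where
  "root_fun A \<xi> \<longleftrightarrow> continuous_on A \<xi> \<and> (\<forall>x\<in>A. \<forall>s. \<xi> (x + s *\<^sub>R b) = \<xi> x) \<and>
     sa_over R' {x\<in>A. \<xi> x < x \<bullet> b} \<and> sa_over R' {x\<in>A. x \<bullet> b < \<xi> x}"

text \<open>Graphs that never meet keep their order over a connected set. Over a nonempty
  \<open>A\<close>, two functions that agree on \<open>A\<close> and differ only elsewhere cannot
  both be members.\<close>

definition slicing :: "'a set \<Rightarrow> ('a \<Rightarrow> real) set \<Rightarrow> bool" where
  "slicing A \<Xi> \<longleftrightarrow> finite \<Xi> \<and> (\<forall>\<xi>\<in>\<Xi>. root_fun A \<xi>) \<and>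
     (\<forall>\<xi>\<in>\<Xi>. \<forall>\<eta>\<in>\<Xi>. \<xi> \<noteq> \<eta> \<longrightarrow> (\<forall>x\<in>A. \<xi> x \<noteq> \<eta> x))"

text \<open>Recording root sets instead of sign conditions makes slicings stable under discarding functions;
  constancy of signs on the pieces follows from connectedness.\<close>

definition sliced :: "'a set \<Rightarrow> ('a \<Rightarrow> real) set \<Rightarrow> ('a \<Rightarrow> real poly) \<Rightarrow> bool" where
  "sliced A \<Xi> P \<longleftrightarrow> (\<forall>x\<in>A. P x = 0) \<or>
     (\<exists>Z\<subseteq>\<Xi>. \<forall>x\<in>A. P x \<noteq> 0 \<and> {t. poly (P x) t = 0} = (\<lambda>\<xi>. \<xi> x) ` Z)"

text \<open>The part of the vertical line over \<open>x\<close> above the graphs in \<open>L\<close>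
  and below the others; for \<open>L \<subseteq> \<Xi>\<close> it is nonempty only if
  \<open>L\<close> is an initial segment at \<open>x\<close>. Indexing by subsets avoids an
  enumeration of \<Xi> in increasing order.\<close>

definition band :: "('a \<Rightarrow> real) set \<Rightarrow> ('a \<Rightarrow> real) set \<Rightarrow> 'a \<Rightarrow> real set" where
  "band \<Xi> L x = gap ((\<lambda>\<xi>. \<xi> x) ` L) ((\<lambda>\<xi>. \<xi> x) ` (\<Xi> - L))"

lemma band_iff: "t \<in> band \<Xi> L x \<longleftrightarrow> (\<forall>\<xi>\<in>L. \<xi> x < t) \<and> (\<forall>\<xi>\<in>\<Xi> - L. t < \<xi> x)"
  by (auto simp: band_def gap_def)

lemma slicing_subset: "slicing A \<Xi> \<Longrightarrow> \<Xi>' \<subseteq> \<Xi> \<Longrightarrow> slicing A \<Xi>'"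
  unfolding slicing_def by (meson finite_subset subsetD)

lemma sliced_mono: "sliced A \<Xi> P \<Longrightarrow> \<Xi> \<subseteq> \<Xi>' \<Longrightarrow> sliced A \<Xi>' P"
  unfolding sliced_def by (meson order_trans)

lemma root_fun_shift: "root_fun A \<xi> \<Longrightarrow> x \<in> A \<Longrightarrow> \<xi> (x + s *\<^sub>R b) = \<xi> x"
  by (simp add: root_fun_def)

lemma slicing_order:
  assumes "cell A" "slicing A \<Xi>" "\<xi> \<in> \<Xi>" "\<eta> \<in> \<Xi>" "x \<in> A" "y \<in> A" "\<xi> x < \<eta> x"
  shows "\<xi> y < \<eta> y"
proof -
  have "\<xi> \<noteq> \<eta>" using assms by auto
  have "sgn (\<eta> x - \<xi> x) = sgn (\<eta> y - \<xi> y)"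
    by (rule connected_sgn_constant[of A])
       (use assms \<open>\<xi> \<noteq> \<eta>\<close> in \<open>auto simp: cell_def slicing_def root_fun_def intro!: continuous_intros\<close>)
  then show ?thesis using assms(7) by (metis diff_gt_0_iff_gt sgn_1_pos)
qed

text \<open>Nonemptiness only says that \<open>L\<close> lies below \<open>\<Xi> - L\<close>, and
  \<open>slicing_order\<close> carries this from one point of the cell to all others.\<close>

lemma band_nonempty:
  assumes "cell A" "slicing A \<Xi>" "L \<subseteq> \<Xi>" "x \<in> A" "y \<in> A" "band \<Xi> L x \<noteq> {}"
  shows "band \<Xi> L y \<noteq> {}"
  unfolding band_def
proof (rule gap_nonempty)
  obtain t where t: "t \<in> band \<Xi> L x" using assms by blast
  fix s u assume "s \<in> (\<lambda>\<xi>. \<xi> y) ` L" "u \<in> (\<lambda>\<xi>. \<xi> y) ` (\<Xi> - L)"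
  then obtain \<xi> \<eta> where *: "\<xi> \<in> L" "\<eta> \<in> \<Xi> - L" "s = \<xi> y" "u = \<eta> y" by auto
  then have "\<xi> x < \<eta> x" using t unfolding band_iff by (meson less_trans)
  then show "s < u" using slicing_order[OF assms(1,2), of \<xi> \<eta> x y] * assms by auto
qed (use assms in \<open>auto simp: slicing_def intro!: finite_imageI intro: finite_subset[OF assms(3)]\<close>)

lemma band_shift:
  assumes "slicing A \<Xi>" "L \<subseteq> \<Xi>" "x \<in> A"
  shows "band \<Xi> L (x + s *\<^sub>R b) = band \<Xi> L x"
proof -
  have "\<forall>\<xi>\<in>\<Xi>. \<xi> (x + s *\<^sub>R b) = \<xi> x" using assms root_fun_shift by (auto simp: slicing_def)
  then have "(\<lambda>\<xi>. \<xi> (x + s *\<^sub>R b)) ` L = (\<lambda>\<xi>. \<xi> x) ` L"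
    "(\<lambda>\<xi>. \<xi> (x + s *\<^sub>R b)) ` (\<Xi> - L) = (\<lambda>\<xi>. \<xi> x) ` (\<Xi> - L)"
    using assms(2) by (auto intro!: image_cong)
  then show ?thesis by (simp add: band_def)
qed

lemma openin_less:
  assumes "continuous_on A f" "continuous_on A g"
  shows "openin (top_of_set A) {x \<in> A. f x < (g x :: real)}"
proof -
  have "openin (top_of_set A) (A \<inter> (\<lambda>x. g x - f x) -` {0<..})"
    by (intro continuous_openin_preimage_gen continuous_intros assms)
  moreover have "A \<inter> (\<lambda>x. g x - f x) -` {0<..} = {x \<in> A. f x < g x}" by auto
  ultimately show ?thesis by simp
qed

lemma connected_band:
  assumes "cell A" "slicing A \<Xi>" "L \<subseteq> \<Xi>" "x0 \<in> A" "band \<Xi> L x0 \<noteq> {}"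
  shows "connected {x \<in> A. x \<bullet> b \<in> band \<Xi> L x}"
proof (rule connected_if_connected_fibres[of A b])
  have fin: "finite L" "finite (\<Xi> - L)" using assms by (auto simp: slicing_def intro: finite_subset)
  have "openin (top_of_set A) ((\<Inter>\<xi>\<in>L. {x \<in> A. \<xi> x < x \<bullet> b}) \<inter> topspace (top_of_set A))"
    using assms fin by (intro openin_INT openin_less) (auto simp: slicing_def root_fun_def intro!: continuous_intros)
  moreover have "openin (top_of_set A) ((\<Inter>\<xi>\<in>\<Xi> - L. {x \<in> A. x \<bullet> b < \<xi> x}) \<inter> topspace (top_of_set A))"
    using assms fin by (intro openin_INT openin_less) (auto simp: slicing_def root_fun_def intro!: continuous_intros)
  moreover have "{x \<in> A. x \<bullet> b \<in> band \<Xi> L x} = 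
      ((\<Inter>\<xi>\<in>L. {x \<in> A. \<xi> x < x \<bullet> b}) \<inter> topspace (top_of_set A)) \<inter>
      ((\<Inter>\<xi>\<in>\<Xi> - L. {x \<in> A. x \<bullet> b < \<xi> x}) \<inter> topspace (top_of_set A))"
    by (auto simp: band_iff)
  ultimately show "openin (top_of_set A) {x \<in> A. x \<bullet> b \<in> band \<Xi> L x}"
    by (simp only: openin_Int)
next
  fix x assume x: "x \<in> A"
  then obtain t where "t \<in> band \<Xi> L x" using band_nonempty[OF assms(1-4) x assms(5)] by blast
  then show "\<exists>s. x + s *\<^sub>R b \<in> {x \<in> A. x \<bullet> b \<in> band \<Xi> L x}"
    using cell_translate[OF assms(1) x] band_shift[OF assms(2,3) x]
    by (intro exI[of _ "t - x \<bullet> b"]) simp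
next
  fix x assume x: "x \<in> A"
  have "{s. x + s *\<^sub>R b \<in> {x \<in> A. x \<bullet> b \<in> band \<Xi> L x}} = {s. x \<bullet> b + s \<in> band \<Xi> L x}"
    using cell_translate[OF assms(1) x] band_shift[OF assms(2,3) x] by simp
  moreover have "is_interval {s. x \<bullet> b + s \<in> band \<Xi> L x}"
    unfolding is_interval_1 band_def
  proof (intro ballI allI impI)
    fix s s' t assume "s \<in> {s. x \<bullet> b + s \<in> gap ((\<lambda>\<xi>. \<xi> x) ` L) ((\<lambda>\<xi>. \<xi> x) ` (\<Xi> - L))}"
      "s' \<in> {s. x \<bullet> b + s \<in> gap ((\<lambda>\<xi>. \<xi> x) ` L) ((\<lambda>\<xi>. \<xi> x) ` (\<Xi> - L))}" "s \<le> t \<and> t \<le> s'"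
    then show "t \<in> {s. x \<bullet> b + s \<in> gap ((\<lambda>\<xi>. \<xi> x) ` L) ((\<lambda>\<xi>. \<xi> x) ` (\<Xi> - L))}"
      using gap_convex[of "x \<bullet> b + s" _ _ "x \<bullet> b + s'" "x \<bullet> b + t"] by simp
  qed
  ultimately show "connected {s. x + s *\<^sub>R b \<in> {x \<in> A. x \<bullet> b \<in> band \<Xi> L x}}"
    using is_interval_connected by simp
qed (use assms cell_translate in \<open>auto simp: cell_def\<close>)

text \<open>All roots of \<open>q\<close> lie on graphs of \<Xi>, so a \<open>q\<close> that is not
  identically zero has no root in the band; as the band over \<open>A\<close> is connected, its sign
  is constant there.\<close>

lemma sliced_sign_on_band:
  assumes "cell A" "slicing A \<Xi>" "sliced A \<Xi> q" "pfun A N q" "L \<subseteq> \<Xi>"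
    and "x \<in> A" "y \<in> A" "t \<in> band \<Xi> L x" "u \<in> band \<Xi> L y"
  shows "sgn (poly (q x) t) = sgn (poly (q y) u)"
    and "(\<forall>x\<in>A. q x = 0) \<or> poly (q x) t \<noteq> 0"
proof -
  have nz: "(\<forall>x\<in>A. q x = 0) \<or> (\<forall>x\<in>A. \<forall>t\<in>band \<Xi> L x. poly (q x) t \<noteq> 0)"
  proof (cases "\<forall>x\<in>A. q x = 0")
    case False
    then obtain Z where Z: "Z \<subseteq> \<Xi>" "\<forall>x\<in>A. {t. poly (q x) t = 0} = (\<lambda>\<xi>. \<xi> x) ` Z"
      using assms(3) unfolding sliced_def by blast
    have "poly (q x) t \<noteq> 0" if "x \<in> A" "t \<in> band \<Xi> L x" for x t
    proof
      assume "poly (q x) t = 0"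
      then have "t \<in> (\<lambda>\<xi>. \<xi> x) ` Z" using Z(2) that(1) by blast
      then show False using that(2) Z(1) by (auto simp: band_iff)
    qed
    then show ?thesis by blast
  qed simp
  then show "(\<forall>x\<in>A. q x = 0) \<or> poly (q x) t \<noteq> 0" using assms by blast
  show "sgn (poly (q x) t) = sgn (poly (q y) u)"
  proof (cases "\<forall>x\<in>A. q x = 0")
    case False
    let ?W = "{x \<in> A. x \<bullet> b \<in> band \<Xi> L x}"
    have W: "lift x t \<in> ?W \<and> q (lift x t) = q x" if "x \<in> A" "t \<in> band \<Xi> L x" for x t
      using that cell_lift[OF assms(1)] band_shift[OF assms(2,5)] pfun_shift[OF assms(4,1)]
      by (simp add: lift_def)
    have "sgn (poly (q (lift x t)) (lift x t \<bullet> b)) = sgn (poly (q (lift y u)) (lift y u \<bullet> b))"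
    proof (rule connected_sgn_constant[of ?W "\<lambda>x. poly (q x) (x \<bullet> b)"])
      show "connected ?W" using connected_band[OF assms(1,2,5,6)] assms(8) by blast
      show "continuous_on ?W (\<lambda>x. poly (q x) (x \<bullet> b))"
        by (rule pfun_continuous[of _ N]) (auto intro!: continuous_intros intro: pfun_mono[OF assms(4)])
    qed (use W assms nz False in auto)
    then show ?thesis using W assms by simp
  qed (use assms in simp)
qed

text \<open>The derivative has constant nonzero sign on the band, so \<open>p\<close> is monotone on
  each fibre. Whether it takes both signs depends only on its signs on the bounding graphs, which
  \<open>sgn_root\<close> keeps constant, or on its growth at infinity. A root over the single point
  \<open>x0\<close> therefore gives exactly one root over every point.\<close>

lemma new_root_fun:
  assumes A: "cell A" and \<Xi>: "slicing A \<Xi>" and p: "pfun A N p"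
    and p': "sliced A \<Xi> (\<lambda>x. pderiv (p x))" and deg: "\<And>x. x \<in> A \<Longrightarrow> degree (p x) > 0"
    and sgn_root: "\<And>\<xi> x y. \<xi> \<in> \<Xi> \<Longrightarrow> x \<in> A \<Longrightarrow> y \<in> A \<Longrightarrow> sgn (poly (p x) (\<xi> x)) = sgn (poly (p y) (\<xi> y))"
    and L: "L \<subseteq> \<Xi>" and x0: "x0 \<in> A" "t0 \<in> band \<Xi> L x0" "poly (p x0) t0 = 0"
  shows "\<exists>\<rho>. root_fun A \<rho> \<and> (\<forall>x\<in>A. \<rho> x \<in> band \<Xi> L x \<and> (\<forall>t\<in>band \<Xi> L x. poly (p x) t = 0 \<longleftrightarrow> t = \<rho> x))"
proof -
  have fin: "finite L" "finite (\<Xi> - L)" using \<Xi> L by (auto simp: slicing_def intro: finite_subset)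
  have rf: "root_fun A \<xi>" if "\<xi> \<in> \<Xi>" for \<xi> using that \<Xi> by (simp add: slicing_def)
  have pd: "pfun A N (\<lambda>x. pderiv (p x))" by (rule pfun_mono[OF pfun_pderiv[OF p]]) auto
  define s where "s = sgn (poly (pderiv (p x0)) t0)"
  have ne: "band \<Xi> L x \<noteq> {}" if "x \<in> A" for x
    using band_nonempty[OF A \<Xi> L x0(1) that] x0(2) by blast
  have "\<not> (\<forall>x\<in>A. pderiv (p x) = 0)" using x0(1) deg pderiv_eq_0_iff by (metis less_irrefl)
  then have s0: "s \<noteq> 0" using sliced_sign_on_band(2)[OF A \<Xi> p' pd L x0(1,1,2,2)] by (auto simp: s_def sgn_zero_iff)
  \<comment> \<open>Multiplying by the sign of the derivative leaves only the increasing
    case.\<close>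
  define P where "P x = smult s (p x)" for x
  have P: "pfun A N P" unfolding P_def by (rule pfun_smult[OF p])
  have degP: "degree (P x) > 0" if "x \<in> A" for x using deg[OF that] s0 by (simp add: P_def)
  have Proot: "poly (P x) t = 0 \<longleftrightarrow> poly (p x) t = 0" for x t using s0 by (simp add: P_def)
  have incr: "poly (pderiv (P x)) t > 0" if "x \<in> A" "t \<in> band \<Xi> L x" for x t
  proof -
    have "sgn (poly (pderiv (p x)) t) = s"
      unfolding s_def using sliced_sign_on_band(1)[OF A \<Xi> p' pd L that(1) x0(1) that(2) x0(2)] by simp
    then have "sgn (poly (pderiv (P x)) t) = s * s" 
      by (simp add: P_def pderiv_smult sgn_mult) (simp add: s_def)
    also have "\<dots> > 0" using s0 by (metis not_real_square_gt_zero)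
    finally show ?thesis by (simp add: sgn_greater)
  qed
  have Psgn: "sgn (poly (P x) (\<xi> x)) = sgn (poly (P y) (\<xi> y))" if "\<xi> \<in> \<Xi>" "x \<in> A" "y \<in> A" for \<xi> x y
    using sgn_root[OF that] by (simp add: P_def sgn_mult)
  have root0: "(\<exists>t\<in>band \<Xi> L x0. poly (P x0) t < 0) \<and> (\<exists>t\<in>band \<Xi> L x0. poly (P x0) t > 0)"
    using poly_root_on_gap_iff[of "(\<lambda>\<xi>. \<xi> x0) ` L" "(\<lambda>\<xi>. \<xi> x0) ` (\<Xi> - L)" "P x0"] fin incr[OF x0(1)]
      x0(2,3) Proot[of x0 t0]
    unfolding band_def by blast
  have neg: "\<exists>t\<in>band \<Xi> L x. poly (P x) t < 0" if x: "x \<in> A" for x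
  proof (cases "L = {}")
    case True
    show ?thesis using poly_negative_on_unbounded_gap[of "(\<lambda>\<xi>. \<xi> x) ` \<Xi>" "P x"] ne[OF x] incr[OF x] degP[OF x]
      unfolding band_def True by simp
  next
    case False
    then have "Max ((\<lambda>\<xi>. \<xi> x0) ` L) \<in> (\<lambda>\<xi>. \<xi> x0) ` L" using fin by (intro Max_in) auto
    \<comment> \<open>The graph of \<open>L\<close> that is topmost over \<open>x0\<close> is
      topmost over all of \<open>A\<close>, so the same \<open>l\<close> bounds the band from below
      everywhere.\<close>
    then obtain l where l: "l \<in> L" "Max ((\<lambda>\<xi>. \<xi> x0) ` L) = l x0" by blast
    have max0: "\<xi> x0 \<le> l x0" if "\<xi> \<in> L" for \<xi>
      using Max_ge[of "(\<lambda>\<xi>. \<xi> x0) ` L" "\<xi> x0"] fin that l(2) by simp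
    have max: "\<xi> y \<le> l y" if "\<xi> \<in> L" "y \<in> A" for \<xi> y
      using max0[OF that(1)] slicing_order[OF A \<Xi>, of l \<xi> y x0] L l(1) that x0(1) by force
    have iff: "(\<exists>t\<in>band \<Xi> L y. poly (P y) t < 0) \<longleftrightarrow> poly (P y) (l y) < 0" if "y \<in> A" for y
      unfolding band_def
      by (rule poly_negative_on_gap_iff) (use l max ne incr that in \<open>auto simp flip: band_def\<close>)
    then show ?thesis using root0 x x0(1) Psgn[of l x0 x] l L by (metis sgn_1_neg subsetD)
  qed
  have pos: "\<exists>t\<in>band \<Xi> L x. poly (P x) t > 0" if x: "x \<in> A" for x
  proof (cases "\<Xi> - L = {}")
    case True
    show ?thesis using poly_positive_on_unbounded_gap[of "(\<lambda>\<xi>. \<xi> x) ` L" "P x"] ne[OF x] incr[OF x] degP[OF x]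
      unfolding band_def True by simp
  next
    case False
    then have "Min ((\<lambda>\<xi>. \<xi> x0) ` (\<Xi> - L)) \<in> (\<lambda>\<xi>. \<xi> x0) ` (\<Xi> - L)" using fin by (intro Min_in) auto
    then obtain l where l: "l \<in> \<Xi> - L" "Min ((\<lambda>\<xi>. \<xi> x0) ` (\<Xi> - L)) = l x0" by blast
    have min0: "l x0 \<le> \<xi> x0" if "\<xi> \<in> \<Xi> - L" for \<xi>
      using Min_le[of "(\<lambda>\<xi>. \<xi> x0) ` (\<Xi> - L)" "\<xi> x0"] fin that l(2) by simp
    have min: "l y \<le> \<xi> y" if "\<xi> \<in> \<Xi> - L" "y \<in> A" for \<xi> y
      using min0[OF that(1)] slicing_order[OF A \<Xi>, of \<xi> l y x0] L l(1) that x0(1) by force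
    have iff: "(\<exists>t\<in>band \<Xi> L y. poly (P y) t > 0) \<longleftrightarrow> poly (P y) (l y) > 0" if "y \<in> A" for y
      unfolding band_def
      by (rule poly_positive_on_gap_iff) (use l min ne incr that in \<open>auto simp flip: band_def\<close>)
    then show ?thesis using root0 x x0(1) Psgn[of l x0 x] l by (metis sgn_1_pos DiffD1)
  qed
  have root: "\<exists>t\<in>band \<Xi> L x. poly (P x) t = 0" if x: "x \<in> A" for x
    using poly_root_on_gap_iff[of "(\<lambda>\<xi>. \<xi> x) ` L" "(\<lambda>\<xi>. \<xi> x) ` (\<Xi> - L)" "P x"] fin incr[OF x] neg[OF x] pos[OF x]
    unfolding band_def by blast
  \<comment> \<open>The choice depends on \<open>x\<close> only through the band and
    \<open>P x\<close>. Both are unchanged along \<open>b\<close>, and hence so is \<rho>.\<close>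
  define \<rho> where "\<rho> x = (SOME t. t \<in> band \<Xi> L x \<and> poly (P x) t = 0)" for x
  have \<rho>: "\<rho> x \<in> band \<Xi> L x \<and> poly (P x) (\<rho> x) = 0" if "x \<in> A" for x
    unfolding \<rho>_def by (rule someI_ex) (use root[OF that] in blast)
  have mono: "poly (P x) t < poly (P x) u" if "x \<in> A" "t \<in> band \<Xi> L x" "u \<in> band \<Xi> L x" "t < u" for x t u
    using that by (intro poly_increasing incr) (auto simp: band_def intro: gap_convex less_imp_le)
  have less: "poly (P x) t < 0 \<longleftrightarrow> t < \<rho> x" and greater: "poly (P x) t > 0 \<longleftrightarrow> \<rho> x < t"
    if "x \<in> A" "t \<in> band \<Xi> L x" for x t
    using mono[OF that(1), of t "\<rho> x"] mono[OF that(1), of "\<rho> x" t] \<rho>[OF that(1)] that(2)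
    by (cases t "\<rho> x" rule: linorder_cases; force)+
  have iff: "poly (p x) t = 0 \<longleftrightarrow> t = \<rho> x" if "x \<in> A" "t \<in> band \<Xi> L x" for x t
    using less[OF that] greater[OF that] \<rho>[OF that(1)] Proot[of x t] by (metis less_irrefl linorder_neqE)
  have ev_band: "\<forall>\<^sub>F y in at x within A. t \<in> band \<Xi> L y" if x: "x \<in> A" "t \<in> band \<Xi> L x" for x t
  proof -
    have lim: "(\<xi> \<longlongrightarrow> \<xi> x) (at x within A)" if "\<xi> \<in> \<Xi>" for \<xi>
      using rf[OF that] x(1) by (auto simp: root_fun_def continuous_on_def)
    have "\<forall>\<^sub>F y in at x within A. \<forall>\<xi>\<in>L. \<xi> y < t"
      using fin L lim x(2) by (intro eventually_ball_finite ballI order_tendstoD(2)) (auto simp: band_iff)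
    moreover have "\<forall>\<^sub>F y in at x within A. \<forall>\<xi>\<in>\<Xi> - L. t < \<xi> y"
      using fin lim x(2) by (intro eventually_ball_finite ballI order_tendstoD(1)) (auto simp: band_iff)
    ultimately show ?thesis by eventually_elim (auto simp: band_iff)
  qed
  have lim_P: "((\<lambda>y. poly (P y) t) \<longlongrightarrow> poly (P x) t) (at x within A)" if "x \<in> A" for x t
    using pfun_continuous[OF P continuous_on_const[of A t]] that by (auto simp: continuous_on_def)
  have open_band: "open (band \<Xi> L x)" for x unfolding band_def using fin by (intro open_gap) auto
  \<comment> \<open>Just below the root \<open>P x\<close> is negative at some \<open>t\<close> of
    the band. For nearby \<open>y\<close> the value at the same \<open>t\<close> is still negative
    and \<open>t\<close> is still in the band, so \<open>t\<close> lies below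
    \<open>\<rho> y\<close>; likewise above the root.\<close>
  have "continuous_on A \<rho>"
    unfolding continuous_on_def
  proof (intro ballI order_tendstoI)
    fix x a assume x: "x \<in> A"
    obtain e where e: "e > 0" "ball (\<rho> x) e \<subseteq> band \<Xi> L x"
      using openE[OF open_band] \<rho>[OF x] by blast
    then have near: "t \<in> band \<Xi> L x" if "\<bar>t - \<rho> x\<bar> < e" for t
      using that by (auto simp: dist_real_def abs_minus_commute subset_iff)
    show "\<forall>\<^sub>F y in at x within A. a < \<rho> y" if "a < \<rho> x"
    proof -
      define t where "t = max a (\<rho> x - e / 2)"
      have t: "t \<in> band \<Xi> L x" "t < \<rho> x" "a \<le> t" using that e(1) by (auto simp: t_def intro!: near)
      then have "poly (P x) t < 0" using less[OF x] by blast
      then have "\<forall>\<^sub>F y in at x within A. poly (P y) t < 0" using lim_P[OF x] by (rule order_tendstoD(2)[rotated])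
      moreover have "\<forall>\<^sub>F y in at x within A. y \<in> A" by (simp add: eventually_at_filter)
      ultimately show ?thesis using ev_band[OF x t(1)]
        by eventually_elim (use less t(3) in force)
    qed
    show "\<forall>\<^sub>F y in at x within A. \<rho> y < a" if "\<rho> x < a"
    proof -
      define t where "t = min a (\<rho> x + e / 2)"
      have t: "t \<in> band \<Xi> L x" "t > \<rho> x" "t \<le> a" using that e(1) by (auto simp: t_def intro!: near)
      then have "poly (P x) t > 0" using greater[OF x] by blast
      then have "\<forall>\<^sub>F y in at x within A. poly (P y) t > 0" using lim_P[OF x] by (rule order_tendstoD(1)[rotated])
      moreover have "\<forall>\<^sub>F y in at x within A. y \<in> A" by (simp add: eventually_at_filter)
      ultimately show ?thesis using ev_band[OF x t(1)]
        by eventually_elim (use greater t(3) in force)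
    qed
  qed
  moreover have "\<rho> (x + s *\<^sub>R b) = \<rho> x" if "x \<in> A" for x s
    unfolding \<rho>_def using band_shift[OF \<Xi> L that] pfun_shift[OF P A that] by simp
  moreover obtain q where q: "q \<in> R'" "\<And>x. x \<in> A \<Longrightarrow> poly (P x) (x \<bullet> b) = q x"
    using pfun_agree[OF P] by blast
  have q': "(\<lambda>x. - q x) \<in> R'"
    using function_ring.uminus[OF function_ring_adjoin] q(1) function_ring_axioms by blast
  have saA: "sa_over R' A"
    using A sa_over_mono[OF _ subset_adjoin[OF function_ring_axioms]] by (simp add: cell_def)
  have sa1: "sa_over R' {x\<in>A. \<xi> x < x \<bullet> b}" and sa2: "sa_over R' {x\<in>A. x \<bullet> b < \<xi> x}" if "\<xi> \<in> \<Xi>" for \<xi>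
    using rf[OF that] by (simp_all add: root_fun_def)
  have "sa_over R' {x\<in>A. \<rho> x < x \<bullet> b}"
  proof -
    \<comment> \<open>Inside the band, being above \<rho> is positivity of \<open>q\<close>. A point
      above \<open>L\<close> that is not in the band has reached a graph of \<open>\<Xi> - L\<close>
      and so is above \<rho> whatever the sign of \<open>q\<close>.\<close>
    have "{x\<in>A. \<rho> x < x \<bullet> b} = A \<inter> (\<Inter>\<xi>\<in>L. {x\<in>A. \<xi> x < x \<bullet> b}) \<inter>
       ((\<Union>\<xi>\<in>\<Xi> - L. A - {x\<in>A. x \<bullet> b < \<xi> x}) \<union> {x. q x > 0})" (is "?l = ?r")
    proof (rule set_eqI)
      fix x
      show "x \<in> ?l \<longleftrightarrow> x \<in> ?r"
      proof (cases "x \<in> A \<and> (\<forall>\<xi>\<in>L. \<xi> x < x \<bullet> b)")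
        case True
        show ?thesis
        proof (cases "x \<bullet> b \<in> band \<Xi> L x")
          case in_band: True
          then show ?thesis using True greater[of x "x \<bullet> b"] q(2)[of x] by (auto simp: band_iff)
        next
          case False
          then obtain \<eta> where "\<eta> \<in> \<Xi> - L" "\<eta> x \<le> x \<bullet> b" using True by (auto simp: band_iff not_less)
          moreover have "\<rho> x < \<eta> x" using \<rho>[of x] True \<open>\<eta> \<in> \<Xi> - L\<close> unfolding band_iff by blast
          ultimately have "\<rho> x < x \<bullet> b" "x \<in> (\<Union>\<xi>\<in>\<Xi> - L. A - {x\<in>A. x \<bullet> b < \<xi> x})"
            using True by (auto intro!: bexI[of _ \<eta>])
          then show ?thesis using True by blast
        qed
      next
        case False
        have "\<forall>\<xi>\<in>L. \<xi> x < x \<bullet> b" if "x \<in> A" "\<rho> x < x \<bullet> b"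
          using \<rho>[OF that(1)] that(2) unfolding band_iff by (meson less_trans)
        then show ?thesis using False by blast
      qed
    qed
    then show ?thesis
      using fin L by (auto intro!: sa_over_Int sa_over_Un sa_over_INT sa_over_UN sa_over_Diff saA sa1 sa2 sa_over_pos q(1))
  qed
  moreover have "sa_over R' {x\<in>A. x \<bullet> b < \<rho> x}"
  proof -
    have "{x\<in>A. x \<bullet> b < \<rho> x} = A \<inter> (\<Inter>\<xi>\<in>\<Xi> - L. {x\<in>A. x \<bullet> b < \<xi> x}) \<inter>
       ((\<Union>\<xi>\<in>L. A - {x\<in>A. \<xi> x < x \<bullet> b}) \<union> {x. - q x > 0})" (is "?l = ?r")
    proof (rule set_eqI)
      fix x
      show "x \<in> ?l \<longleftrightarrow> x \<in> ?r"
      proof (cases "x \<in> A \<and> (\<forall>\<xi>\<in>\<Xi> - L. x \<bullet> b < \<xi> x)")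
        case True
        show ?thesis
        proof (cases "x \<bullet> b \<in> band \<Xi> L x")
          case in_band: True
          then show ?thesis using True less[of x "x \<bullet> b"] q(2)[of x] by (auto simp: band_iff)
        next
          case False
          then obtain \<eta> where "\<eta> \<in> L" "x \<bullet> b \<le> \<eta> x" using True by (auto simp: band_iff not_less)
          moreover have "\<eta> x < \<rho> x" using \<rho>[of x] True \<open>\<eta> \<in> L\<close> unfolding band_iff by blast
          ultimately have "x \<bullet> b < \<rho> x" "x \<in> (\<Union>\<xi>\<in>L. A - {x\<in>A. \<xi> x < x \<bullet> b})"
            using True by (auto intro!: bexI[of _ \<eta>])
          then show ?thesis using True by blast
        qed
      next
        case False
        have "\<forall>\<xi>\<in>\<Xi> - L. x \<bullet> b < \<xi> x" if "x \<in> A" "x \<bullet> b < \<rho> x"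
          using \<rho>[OF that(1)] that(2) unfolding band_iff by (meson less_trans)
        then show ?thesis using False by blast
      qed
    qed
    then show ?thesis
      using fin L sa_over_pos[OF q']
      by (auto intro!: sa_over_Int sa_over_Un sa_over_INT sa_over_UN sa_over_Diff saA sa1 sa2)
  qed
  ultimately have "root_fun A \<rho>" by (simp add: root_fun_def)
  then show ?thesis using \<rho> iff by blast
qed

text \<open>A root of \<open>p\<close> lies either on an old graph, along which the sign of
  \<open>p\<close> is constant, or in a band, which contributes one new graph. New graphs avoid the
  old ones because they stay inside bands, and each other because different bands over a point are
  disjoint.\<close>

lemma slicing_add_roots:
  assumes A: "cell A" and \<Xi>: "slicing A \<Xi>" and p: "pfun A N p"
    and p': "sliced A \<Xi> (\<lambda>x. pderiv (p x))" and deg: "\<And>x. x \<in> A \<Longrightarrow> degree (p x) > 0"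
    and sgn_root: "\<And>\<xi> x y. \<xi> \<in> \<Xi> \<Longrightarrow> x \<in> A \<Longrightarrow> y \<in> A \<Longrightarrow> sgn (poly (p x) (\<xi> x)) = sgn (poly (p y) (\<xi> y))"
  shows "\<exists>\<Xi>'. \<Xi> \<subseteq> \<Xi>' \<and> slicing A \<Xi>' \<and> sliced A \<Xi>' p"
proof -
  define \<L> where "\<L> = {L \<in> Pow \<Xi>. \<exists>x\<in>A. \<exists>t\<in>band \<Xi> L x. poly (p x) t = 0}"
  have "finite \<Xi>" using \<Xi> by (simp add: slicing_def)
  have "\<forall>L\<in>\<L>. \<exists>\<rho>. root_fun A \<rho> \<and> (\<forall>x\<in>A. \<rho> x \<in> band \<Xi> L x \<and> (\<forall>t\<in>band \<Xi> L x. poly (p x) t = 0 \<longleftrightarrow> t = \<rho> x))"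
  proof
    fix L assume "L \<in> \<L>"
    then obtain x t where "L \<subseteq> \<Xi>" "x \<in> A" "t \<in> band \<Xi> L x" "poly (p x) t = 0" unfolding \<L>_def by blast
    then show "\<exists>\<rho>. root_fun A \<rho> \<and> (\<forall>x\<in>A. \<rho> x \<in> band \<Xi> L x \<and> (\<forall>t\<in>band \<Xi> L x. poly (p x) t = 0 \<longleftrightarrow> t = \<rho> x))"
      by (intro new_root_fun[OF A \<Xi> p p' deg sgn_root])
  qed
  then obtain \<rho> where \<rho>: "\<forall>L\<in>\<L>. root_fun A (\<rho> L) \<and> (\<forall>x\<in>A. \<rho> L x \<in> band \<Xi> L x \<and>
      (\<forall>t\<in>band \<Xi> L x. poly (p x) t = 0 \<longleftrightarrow> t = \<rho> L x))"
    by (rule bchoice[THEN exE])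
  define \<Xi>' where "\<Xi>' = \<Xi> \<union> \<rho> ` \<L>"
  have new_old: "\<rho> L x \<noteq> \<xi> x" if "L \<in> \<L>" "\<xi> \<in> \<Xi>" "x \<in> A" for L \<xi> x
  proof -
    have "\<rho> L x \<in> band \<Xi> L x" using \<rho> that by blast
    then show ?thesis using that(2) unfolding band_iff by (metis DiffI less_irrefl)
  qed
  have new_new: "\<rho> L x \<noteq> \<rho> M x" if "L \<in> \<L>" "M \<in> \<L>" "L \<noteq> M" "x \<in> A" for L M x
  proof
    assume eq: "\<rho> L x = \<rho> M x"
    have b: "\<rho> L x \<in> band \<Xi> L x" "\<rho> M x \<in> band \<Xi> M x" using \<rho> that by blast+
    have sub: "L \<subseteq> \<Xi>" "M \<subseteq> \<Xi>" using that by (auto simp: \<L>_def)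
    obtain \<xi> where "\<xi> \<in> L - M \<or> \<xi> \<in> M - L" using \<open>L \<noteq> M\<close> by blast
    then show False using b eq sub unfolding band_iff by (metis Diff_iff less_asym subsetD)
  qed
  have "slicing A \<Xi>'"
    unfolding slicing_def
  proof (intro conjI ballI impI)
    show "finite \<Xi>'" using \<open>finite \<Xi>\<close> by (simp add: \<Xi>'_def \<L>_def)
    show "root_fun A \<xi>" if "\<xi> \<in> \<Xi>'" for \<xi> using that \<rho> \<Xi> by (auto simp: \<Xi>'_def slicing_def)
    fix \<xi> \<eta> x assume *: "\<xi> \<in> \<Xi>'" "\<eta> \<in> \<Xi>'" "\<xi> \<noteq> \<eta>" "x \<in> A"
    have old: "\<xi> \<in> \<Xi> \<Longrightarrow> \<eta> \<in> \<Xi> \<Longrightarrow> \<xi> x \<noteq> \<eta> x" using \<Xi> * unfolding slicing_def by blast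
    show "\<xi> x \<noteq> \<eta> x"
    proof (cases "\<xi> \<in> \<Xi>"; cases "\<eta> \<in> \<Xi>")
      assume "\<xi> \<in> \<Xi>" "\<eta> \<notin> \<Xi>"
      then obtain L where "L \<in> \<L>" "\<eta> = \<rho> L" using * by (auto simp: \<Xi>'_def)
      then show ?thesis using new_old[of L \<xi> x] \<open>\<xi> \<in> \<Xi>\<close> * by simp
    next
      assume "\<xi> \<notin> \<Xi>" "\<eta> \<in> \<Xi>"
      then obtain L where "L \<in> \<L>" "\<xi> = \<rho> L" using * by (auto simp: \<Xi>'_def)
      then show ?thesis using new_old[of L \<eta> x] \<open>\<eta> \<in> \<Xi>\<close> * by simp
    next
      assume "\<xi> \<notin> \<Xi>" "\<eta> \<notin> \<Xi>"
      then obtain L M where "L \<in> \<L>" "\<xi> = \<rho> L" "M \<in> \<L>" "\<eta> = \<rho> M" using * by (auto simp: \<Xi>'_def)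
      then show ?thesis using new_new[of L M x] * by auto
    qed (use old in auto)
  qed
  moreover have "sliced A \<Xi>' p"
    unfolding sliced_def
  proof (intro disjI2 exI conjI ballI)
    \<comment> \<open>A single zero of \<open>p\<close> on an old graph makes \<open>p\<close>
      vanish along the whole graph, by \<open>sgn_root\<close>.\<close>
    define Z where "Z = {\<xi>\<in>\<Xi>. \<exists>x\<in>A. poly (p x) (\<xi> x) = 0} \<union> \<rho> ` \<L>"
    show "Z \<subseteq> \<Xi>'" by (auto simp: Z_def \<Xi>'_def)
    fix x assume x: "x \<in> A"
    show "p x \<noteq> 0" using deg[OF x] by auto
    show "{t. poly (p x) t = 0} = (\<lambda>\<xi>. \<xi> x) ` Z"
    proof (intro equalityI subsetI)
      fix t assume "t \<in> {t. poly (p x) t = 0}"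
      then have t: "poly (p x) t = 0" by simp
      show "t \<in> (\<lambda>\<xi>. \<xi> x) ` Z"
      proof (cases "\<exists>\<xi>\<in>\<Xi>. \<xi> x = t")
        case True
        then show ?thesis using t x by (auto simp: Z_def)
      next
        case False
        \<comment> \<open>The graphs below \<open>t\<close> determine the band that contains
          \<open>t\<close>.\<close>
        define L where "L = {\<xi>\<in>\<Xi>. \<xi> x < t}"
        have tL: "t \<in> band \<Xi> L x" using False by (auto simp: band_iff L_def)
        then have "L \<in> \<L>" using x t by (auto simp: \<L>_def L_def)
        then show ?thesis using \<rho> tL t x by (auto simp: Z_def)
      qed
    next
      fix t assume "t \<in> (\<lambda>\<xi>. \<xi> x) ` Z"
      then obtain \<xi> where \<xi>: "\<xi> \<in> Z" "t = \<xi> x" by blast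
      have "poly (p x) (\<xi> x) = 0" using \<xi>(1) unfolding Z_def
      proof
        assume "\<xi> \<in> {\<xi>\<in>\<Xi>. \<exists>x\<in>A. poly (p x) (\<xi> x) = 0}"
        then obtain z where "\<xi> \<in> \<Xi>" "z \<in> A" "poly (p z) (\<xi> z) = 0" by blast
        then show ?thesis using sgn_root[of \<xi> x z] x by (simp add: sgn_zero_iff)
      next
        assume "\<xi> \<in> \<rho> ` \<L>"
        then show ?thesis using \<rho> x by auto
      qed
      then show "t \<in> {t. poly (p x) t = 0}" using \<xi> by simp
    qed
  qed
  moreover have "\<Xi> \<subseteq> \<Xi>'" by (simp add: \<Xi>'_def)
  ultimately show ?thesis by blast
qed

text \<open>If \<open>r\<close> has no zero along the graph of \<xi>, connectedness fixes its sign.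
  If it has one and is not identically zero, the graph meets a root graph of \<open>r\<close>;
  graphs that meet coincide, so \<open>r\<close> vanishes all along \<xi>.\<close>

lemma sliced_root_sgn:
  assumes A: "cell A" and \<Xi>: "slicing A \<Xi>" and r: "pfun A N r" "sliced A \<Xi> r"
    and "\<xi> \<in> \<Xi>" "x \<in> A" "y \<in> A"
  shows "sgn (poly (r x) (\<xi> x)) = sgn (poly (r y) (\<xi> y))"
proof (cases "\<forall>x\<in>A. poly (r x) (\<xi> x) \<noteq> 0")
  case True
  show ?thesis
    by (rule connected_sgn_constant[of A "\<lambda>x. poly (r x) (\<xi> x)"])
       (use assms True in \<open>auto simp: cell_def slicing_def root_fun_def intro!: pfun_continuous[OF r(1)]\<close>)
next
  case False
  have "poly (r z) (\<xi> z) = 0" if "z \<in> A" for z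
  proof (cases "\<forall>x\<in>A. r x = 0")
    case False
    then obtain Z where Z: "Z \<subseteq> \<Xi>" "\<forall>x\<in>A. {t. poly (r x) t = 0} = (\<lambda>\<xi>. \<xi> x) ` Z"
      using r(2) unfolding sliced_def by blast
    obtain x' where x': "x' \<in> A" "poly (r x') (\<xi> x') = 0" using \<open>\<not> (\<forall>x\<in>A. poly (r x) (\<xi> x) \<noteq> 0)\<close> by blast
    then obtain \<eta> where "\<eta> \<in> Z" "\<xi> x' = \<eta> x'" using Z(2) by blast
    then have "\<xi> \<in> Z" using \<Xi> \<open>\<xi> \<in> \<Xi>\<close> Z(1) x'(1) unfolding slicing_def by (metis subsetD)
    then show ?thesis using Z(2) that by blast
  qed (use that in simp)
  then show ?thesis using assms by simp
qed

text \<open>The remainders must be sliced by the old \<Xi>, so that their signs along its graphs are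
  constant, but they need not belong to \<open>F\<close>: once they have served, they are
  dropped.\<close>

lemma slicing_extend:
  assumes A: "cell A" and \<Xi>: "slicing A \<Xi>" and p: "pfun A N p" and deg: "\<And>x. x \<in> A \<Longrightarrow> degree (p x) > 0"
    and F: "\<And>q. q \<in> F \<Longrightarrow> sliced A \<Xi> q" and p': "(\<lambda>x. pderiv (p x)) \<in> F"
    and rem: "\<And>q. q \<in> F \<Longrightarrow> (\<forall>x\<in>A. q x = 0) \<or> (\<exists>r M. pfun A M r \<and> sliced A \<Xi> r \<and>
       (\<forall>x\<in>A. \<forall>t. poly (q x) t = 0 \<longrightarrow> sgn (poly (r x) t) = sgn (poly (p x) t)))"
  shows "\<exists>\<Xi>'. slicing A \<Xi>' \<and> (\<forall>q\<in>insert p F. sliced A \<Xi>' q)"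
proof -
  text \<open>Only the roots of members of \<open>F\<close> are kept: on the other functions in \<open>\<Xi>\<close> the sign of \<open>p\<close> is not controlled.\<close>
  define \<Xi>0 where "\<Xi>0 = {\<xi>\<in>\<Xi>. \<exists>q\<in>F. \<forall>x\<in>A. q x \<noteq> 0 \<and> poly (q x) (\<xi> x) = 0}"
  have \<Xi>0: "slicing A \<Xi>0" by (rule slicing_subset[OF \<Xi>]) (auto simp: \<Xi>0_def)
  have F0: "sliced A \<Xi>0 q" if q: "q \<in> F" for q
  proof (cases "\<forall>x\<in>A. q x = 0")
    case False
    then obtain Z where Z: "Z \<subseteq> \<Xi>" "\<forall>x\<in>A. q x \<noteq> 0 \<and> {t. poly (q x) t = 0} = (\<lambda>\<xi>. \<xi> x) ` Z"
      using F[OF q] unfolding sliced_def by blast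
    have "Z \<subseteq> \<Xi>0"
    proof
      fix \<xi> assume "\<xi> \<in> Z"
      then have "\<forall>x\<in>A. q x \<noteq> 0 \<and> poly (q x) (\<xi> x) = 0" using Z(2) by blast
      then show "\<xi> \<in> \<Xi>0" using Z(1) \<open>\<xi> \<in> Z\<close> q by (auto simp: \<Xi>0_def)
    qed
    then show ?thesis using Z(2) unfolding sliced_def by blast
  qed (simp add: sliced_def)
  have "\<exists>\<Xi>'. \<Xi>0 \<subseteq> \<Xi>' \<and> slicing A \<Xi>' \<and> sliced A \<Xi>' p"
  proof (rule slicing_add_roots[OF A \<Xi>0 p F0[OF p'] deg])
    fix \<xi> x y assume *: "\<xi> \<in> \<Xi>0" "x \<in> A" "y \<in> A"
    then obtain q where q: "\<xi> \<in> \<Xi>" "q \<in> F" "\<forall>x\<in>A. q x \<noteq> 0 \<and> poly (q x) (\<xi> x) = 0" by (auto simp: \<Xi>0_def)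
    then obtain r M where r: "pfun A M r" "sliced A \<Xi> r"
       "\<forall>x\<in>A. \<forall>t. poly (q x) t = 0 \<longrightarrow> sgn (poly (r x) t) = sgn (poly (p x) t)"
      using rem[OF q(2)] *(2) by blast
    have "sgn (poly (r x) (\<xi> x)) = sgn (poly (r y) (\<xi> y))"
      using sliced_root_sgn[OF A \<Xi> r(1,2) q(1)] * by blast
    then show "sgn (poly (p x) (\<xi> x)) = sgn (poly (p y) (\<xi> y))" using r(3) q(3) * by simp
  qed
  then show ?thesis using F0 sliced_mono by blast
qed

text \<open>Degree and vanishing depend only on which coefficients are zero, so it suffices to fix
  the signs of the finitely many coefficient functions up to index \<open>N\<close>.\<close>

lemma refine_degrees:
  assumes A: "cell A" and "finite F" and F: "\<And>P. P \<in> F \<Longrightarrow> pfun A N P"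
  obtains \<A> where "finite \<A>" "\<Union>\<A> = A" "\<And>A'. A' \<in> \<A> \<Longrightarrow> cell A' \<and> A' \<subseteq> A"
    "\<And>A' P x y. A' \<in> \<A> \<Longrightarrow> P \<in> F \<Longrightarrow> x \<in> A' \<Longrightarrow> y \<in> A' \<Longrightarrow>
       degree (P x) = degree (P y) \<and> (P x = 0 \<longleftrightarrow> P y = 0)"
proof -
  have "\<forall>P\<in>F. \<forall>i. \<exists>q. q \<in> R \<and> (\<forall>x\<in>A. coeff (P x) i = q x)" using F unfolding pfun_def by blast
  then obtain c where c: "\<And>P i. P \<in> F \<Longrightarrow> c P i \<in> R" "\<And>P i x. P \<in> F \<Longrightarrow> x \<in> A \<Longrightarrow> coeff (P x) i = c P i x"
    by metis
  define Q where "Q = (\<lambda>(P, i). c P i) ` (F \<times> {..N})"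
  have "finite Q" "Q \<subseteq> R" using assms(2) c(1) by (auto simp: Q_def)
  from cell_refine[OF A this] obtain \<A> where \<A>: "finite \<A>" "\<Union>\<A> = A"
    "\<And>A'. A' \<in> \<A> \<Longrightarrow> cell A' \<and> A' \<subseteq> A \<and> (\<forall>x\<in>A'. \<forall>y\<in>A'. same_signs Q x y)" by metis
  show ?thesis
  proof (rule that[OF \<A>(1,2)])
    fix A' P x y assume *: "A' \<in> \<A>" "P \<in> F" "x \<in> A'" "y \<in> A'"
    have xy: "x \<in> A" "y \<in> A" and signs: "same_signs Q x y" using * \<A>(3) by blast+
    have "coeff (P x) i = 0 \<longleftrightarrow> coeff (P y) i = 0" for i
    proof (cases "i \<le> N")
      case True
      then have "c P i \<in> Q" using *(2) by (force simp: Q_def)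
      then have "sgn (c P i x) = sgn (c P i y)" using signs by (simp add: same_signs_def)
      then show ?thesis using c(2)[OF *(2)] xy by (metis sgn_zero_iff)
    next
      case False
      then have "degree (P x) < i" "degree (P y) < i" using F[OF *(2)] xy by (auto simp: pfun_def)
      then show ?thesis by (simp add: coeff_eq_0)
    qed
    then show "degree (P x) = degree (P y) \<and> (P x = 0 \<longleftrightarrow> P y = 0)"
      using degree_eq_if_same_support by blast
  qed (use \<A>(3) in blast)
qed

section \<open>Slicing finitely many polynomials, by induction on the degree\<close>

definition sliceable :: "'a set \<Rightarrow> ('a \<Rightarrow> real poly) set \<Rightarrow> bool" where
  "sliceable A F \<longleftrightarrow> (\<exists>\<A>. finite \<A> \<and> \<Union>\<A> = A \<and>
     (\<forall>A'\<in>\<A>. cell A' \<and> (\<exists>\<Xi>. slicing A' \<Xi> \<and> (\<forall>P\<in>F. sliced A' \<Xi> P))))"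

lemma sliceable_Union:
  assumes "finite \<A>" "\<Union>\<A> = A" "\<And>A'. A' \<in> \<A> \<Longrightarrow> sliceable A' F"
  shows "sliceable A F"
proof -
  have "\<forall>A'\<in>\<A>. \<exists>\<B>. finite \<B> \<and> \<Union>\<B> = A' \<and>
     (\<forall>B\<in>\<B>. cell B \<and> (\<exists>\<Xi>. slicing B \<Xi> \<and> (\<forall>P\<in>F. sliced B \<Xi> P)))"
    using assms(3) by (simp add: sliceable_def)
  then obtain \<B> where \<B>: "\<forall>A'\<in>\<A>. finite (\<B> A') \<and> \<Union>(\<B> A') = A' \<and>
     (\<forall>B\<in>\<B> A'. cell B \<and> (\<exists>\<Xi>. slicing B \<Xi> \<and> (\<forall>P\<in>F. sliced B \<Xi> P)))"
    by (rule bchoice[THEN exE])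
  have "\<Union>(\<Union>A'\<in>\<A>. \<B> A') = (\<Union>A'\<in>\<A>. \<Union>(\<B> A'))" by blast
  also have "\<dots> = A" using \<B> assms(2) by auto
  finally show ?thesis unfolding sliceable_def
    using \<B> assms(1) by (intro exI[of _ "\<Union>A'\<in>\<A>. \<B> A'"]) auto
qed

lemma slicing_exists:
  "cell A \<Longrightarrow> finite F \<Longrightarrow> (\<And>P. P \<in> F \<Longrightarrow> pfun A d P) \<Longrightarrow> sliceable A F"
proof (induction d arbitrary: A F)
  case 0
  from refine_degrees[OF 0] obtain \<A> where \<A>: "finite \<A>" "\<Union>\<A> = A" "\<And>A'. A' \<in> \<A> \<Longrightarrow> cell A' \<and> A' \<subseteq> A"
    "\<And>A' P x y. A' \<in> \<A> \<Longrightarrow> P \<in> F \<Longrightarrow> x \<in> A' \<Longrightarrow> y \<in> A' \<Longrightarrow>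
       degree (P x) = degree (P y) \<and> (P x = 0 \<longleftrightarrow> P y = 0)" by blast
  \<comment> \<open>A nonzero polynomial of degree 0 in the new variable has no roots, so no graphs
    are needed.\<close>
  have "sliced A' {} P" if *: "A' \<in> \<A>" "P \<in> F" for A' P
  proof (cases "\<forall>x\<in>A'. P x = 0")
    case False
    have "P x \<noteq> 0 \<and> {t. poly (P x) t = 0} = {}" if "x \<in> A'" for x
    proof -
      have nz: "P x \<noteq> 0" using \<A>(4)[OF * that] False by blast
      moreover have "degree (P x) = 0" using 0(3)[OF *(2)] \<A>(3)[OF *(1)] that by (auto simp: pfun_def)
      ultimately show ?thesis by (auto elim!: degree_eq_zeroE)
    qed
    then show ?thesis unfolding sliced_def by blast
  qed (simp add: sliced_def)
  moreover have "slicing A' {}" for A' by (simp add: slicing_def)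
  ultimately show ?case unfolding sliceable_def
    using \<A>(1-3) by (intro exI[of _ \<A>] conjI ballI exI[of _ "{}"]) auto
next
  case (Suc d)
  \<comment> \<open>Inner induction on \<open>D\<close>, the functions whose degree may be
    \<open>Suc d\<close>. The set \<open>L\<close> of lower degree is arbitrary, so that it can
    absorb the derivative and the remainders when \<open>p\<close> leaves \<open>D\<close>.\<close>
  have "cell A \<Longrightarrow> finite L \<Longrightarrow> (\<And>P. P \<in> D \<Longrightarrow> pfun A (Suc d) P) \<Longrightarrow> (\<And>P. P \<in> L \<Longrightarrow> pfun A d P) \<Longrightarrow> sliceable A (D \<union> L)"
    if "finite D" for A D L
    using that
  proof (induction D arbitrary: A L rule: finite_induct)
    case empty
    then show ?case using Suc.IH by simp
  next
    case (insert p D)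
    let ?F = "insert p (D \<union> L)"
    have "finite ?F" using insert by simp
    moreover have "pfun A (Suc d) P" if "P \<in> ?F" for P
      using that insert.prems(3)[of P] insert.prems(4)[of P] pfun_mono[of A d P A "Suc d"] by auto
    ultimately obtain \<A> where \<A>: "finite \<A>" "\<Union>\<A> = A" "\<And>A'. A' \<in> \<A> \<Longrightarrow> cell A' \<and> A' \<subseteq> A"
      "\<And>A' P x y. A' \<in> \<A> \<Longrightarrow> P \<in> ?F \<Longrightarrow> x \<in> A' \<Longrightarrow> y \<in> A' \<Longrightarrow>
         degree (P x) = degree (P y) \<and> (P x = 0 \<longleftrightarrow> P y = 0)"
      using refine_degrees[OF insert.prems(1), of ?F "Suc d"] by blast
    have "sliceable A' (insert p D \<union> L)" if A': "A' \<in> \<A>" for A'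
    proof -
      have cA': "cell A'" and sub: "A' \<subseteq> A" using \<A>(3)[OF A'] by auto
      have D: "pfun A' (Suc d) P" if "P \<in> insert p D" for P
        using insert.prems(3)[OF that] sub by (rule pfun_mono) simp
      have L: "pfun A' d P" if "P \<in> L" for P
        using insert.prems(4)[OF that] sub by (rule pfun_mono) simp
      obtain x0 where x0: "x0 \<in> A'" using cA' by (auto simp: cell_def)
      show ?thesis
      \<comment> \<open>On this subcell the degree of \<open>p\<close> may have dropped; then
        \<open>p\<close> just moves from \<open>D\<close> to \<open>L\<close>.\<close>
      proof (cases "degree (p x0) \<le> d")
        case True
        then have "pfun A' d p" using D[of p] \<A>(4)[OF A' _ _ x0, of p] by (auto simp: pfun_def)
        then have "sliceable A' (D \<union> insert p L)"
          using D L by (intro insert.IH cA') (auto simp: \<open>finite L\<close>)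
        then show ?thesis by simp
      next
        case False
        have degp: "degree (p x) = Suc d" if "x \<in> A'" for x
          using \<A>(4)[OF A' _ that x0, of p] D[of p] x0 False by (auto simp: pfun_def intro: antisym not_less_eq_eq)
        let ?p' = "\<lambda>x. pderiv (p x)"
        have pfp': "pfun A' d ?p'" using pfun_pderiv[OF D[of p]] by simp
        let ?F2 = "insert ?p' (D \<union> L)"
        have const: "degree (q x) = degree (q y) \<and> (q x = 0 \<longleftrightarrow> q y = 0)" 
          if "q \<in> ?F2" "x \<in> A'" "y \<in> A'" for q x y
        proof (cases "q = ?p'")
          case True
          then show ?thesis using degp that by (simp add: degree_pderiv pderiv_eq_0_iff)
        next
          case False
          then show ?thesis using \<A>(4)[OF A' _ that(2,3), of q] that(1) by blast
        qed
        have pfF2: "pfun A' (Suc d) q" if "q \<in> ?F2" for q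
          using that D[of q] L[of q] pfp' pfun_mono[of A' d q A' "Suc d"] by auto
        have "\<forall>q\<in>?F2. \<exists>r. pfun A' d r \<and> ((\<forall>x\<in>A'. q x = 0) \<or>
           (\<forall>x\<in>A'. \<forall>t. poly (q x) t = 0 \<longrightarrow> sgn (poly (r x) t) = sgn (poly (p x) t)))"
        proof
          fix q assume q: "q \<in> ?F2"
          have pf0: "pfun A' d (\<lambda>_. 0)" using const[of q] function_ring.const[OF function_ring_axioms, of 0] by (auto simp: pfun_def)
          show "\<exists>r. pfun A' d r \<and> ((\<forall>x\<in>A'. q x = 0) \<or>
           (\<forall>x\<in>A'. \<forall>t. poly (q x) t = 0 \<longrightarrow> sgn (poly (r x) t) = sgn (poly (p x) t)))"
          \<comment> \<open>A divisor of degree 0 vanishes identically or has no root; either way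
            the zero polynomial serves as remainder.\<close>
          proof (cases "degree (q x0) = 0")
            case True
            have "poly (q x) t \<noteq> 0 \<or> (\<forall>x\<in>A'. q x = 0)" if "x \<in> A'" for x t
            proof -
              have "degree (q x) = 0" using const[OF q that x0] True by simp
              then obtain c where "q x = [:c:]" by (metis degree_0_id)
              then show ?thesis using const[OF q that] by auto
            qed
            then show ?thesis using pf0 by blast
          next
            case False
            define m where "m = degree (q x0)"
            have m: "m > 0" "\<And>x. x \<in> A' \<Longrightarrow> degree (q x) = m" using False const[OF q _ x0] by (auto simp: m_def)
            obtain r where r: "pfun A' (m - 1) r"
              "\<forall>x\<in>A'. \<forall>t. poly (q x) t = 0 \<longrightarrow> sgn (poly (r x) t) = sgn (poly (p x) t)"
              using pseudo_remainder[OF pfF2[OF q] m(2,1) D[of p]] by auto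
            have "m - 1 \<le> d" using pfF2[OF q] x0 by (auto simp: m_def pfun_def)
            then show ?thesis using r pfun_mono[OF r(1) order_refl] by blast
          qed
        qed
        then obtain rr where rr: "\<forall>q\<in>?F2. pfun A' d (rr q) \<and> ((\<forall>x\<in>A'. q x = 0) \<or>
           (\<forall>x\<in>A'. \<forall>t. poly (q x) t = 0 \<longrightarrow> sgn (poly (rr q x) t) = sgn (poly (p x) t)))"
          by (rule bchoice[THEN exE])
        have "sliceable A' (D \<union> insert ?p' (L \<union> rr ` ?F2))"
        proof (rule insert.IH[OF cA'])
          show "finite (insert ?p' (L \<union> rr ` ?F2))" using insert by simp
          show "pfun A' d P" if "P \<in> insert ?p' (L \<union> rr ` ?F2)" for P
            using that L pfp' rr by (elim insertE UnE imageE) auto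
        qed (use D in blast)
        then obtain \<B> where \<B>: "finite \<B>" "\<Union>\<B> = A'" "\<And>B. B \<in> \<B> \<Longrightarrow> cell B"
          "\<And>B. B \<in> \<B> \<Longrightarrow> \<exists>\<Xi>. slicing B \<Xi> \<and> (\<forall>P\<in>D \<union> insert ?p' (L \<union> rr ` ?F2). sliced B \<Xi> P)"
          unfolding sliceable_def by metis
        have "\<exists>\<Xi>. slicing B \<Xi> \<and> (\<forall>P\<in>insert p D \<union> L. sliced B \<Xi> P)" if B: "B \<in> \<B>" for B
        proof -
          have BA: "B \<subseteq> A'" using B \<B>(2) by blast
          obtain \<Xi> where \<Xi>: "slicing B \<Xi>" "\<forall>P\<in>D \<union> insert ?p' (L \<union> rr ` ?F2). sliced B \<Xi> P"
            using \<B>(4)[OF B] by blast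
          have "\<exists>\<Xi>'. slicing B \<Xi>' \<and> (\<forall>q\<in>insert p ?F2. sliced B \<Xi>' q)"
          proof (rule slicing_extend[OF \<B>(3)[OF B] \<Xi>(1), where N = "Suc d"])
            show "pfun B (Suc d) p" using D[of p] BA pfun_mono by blast
            show "degree (p x) > 0" if "x \<in> B" for x using degp that BA by auto
            show "sliced B \<Xi> q" if "q \<in> ?F2" for q using \<Xi>(2) that by blast
            show "?p' \<in> ?F2" by simp
            fix q assume q: "q \<in> ?F2"
            have "pfun B d (rr q)" using pfun_mono[OF conjunct1[OF bspec[OF rr q]] BA] by simp
            moreover have "sliced B \<Xi> (rr q)" using \<Xi>(2) q by blast
            moreover have "(\<forall>x\<in>A'. q x = 0) \<or>
              (\<forall>x\<in>A'. \<forall>t. poly (q x) t = 0 \<longrightarrow> sgn (poly (rr q x) t) = sgn (poly (p x) t))"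
              by (rule conjunct2[OF bspec[OF rr q]])
            ultimately show "(\<forall>x\<in>B. q x = 0) \<or> (\<exists>r M. pfun B M r \<and> sliced B \<Xi> r \<and>
               (\<forall>x\<in>B. \<forall>t. poly (q x) t = 0 \<longrightarrow> sgn (poly (r x) t) = sgn (poly (p x) t)))"
              using BA by blast
          qed
          then show ?thesis by blast
        qed
        then show ?thesis unfolding sliceable_def using \<B>(1-3) by blast
      qed
    qed
    then show ?case by (rule sliceable_Union[OF \<A>(1,2)])
  qed
  from this[of F A "{}"] show ?case using Suc.prems by simp
qed

section \<open>Cutting the cylinder over a cell into bands and graphs\<close>

definition piece :: "'a set \<Rightarrow> ('a \<Rightarrow> real) set \<Rightarrow> ('a \<Rightarrow> real) set \<Rightarrow> ('a \<Rightarrow> real) set \<Rightarrow> 'a set" where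
  "piece A \<Xi> L M = {x \<in> A. \<forall>\<xi>\<in>\<Xi>. (\<xi> x < x \<bullet> b \<longleftrightarrow> \<xi> \<in> L) \<and> (\<xi> x = x \<bullet> b \<longleftrightarrow> \<xi> \<in> M)}"

lemma piece_band:
  assumes "L \<subseteq> \<Xi>"
  shows "piece A \<Xi> L {} = {x \<in> A. x \<bullet> b \<in> band \<Xi> L x}"
proof -
  have "(\<forall>\<xi>\<in>\<Xi>. (\<xi> x < t \<longleftrightarrow> \<xi> \<in> L) \<and> (\<xi> x = t \<longleftrightarrow> \<xi> \<in> {})) \<longleftrightarrow> t \<in> band \<Xi> L x" for x t
  proof
    assume "t \<in> band \<Xi> L x"
    then have "(\<xi> x < t \<longleftrightarrow> \<xi> \<in> L) \<and> \<xi> x \<noteq> t" if "\<xi> \<in> \<Xi>" for \<xi>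
    proof (cases "\<xi> \<in> L")
      case False
      then have "t < \<xi> x" using \<open>t \<in> band \<Xi> L x\<close> that unfolding band_iff by blast
      then show ?thesis using False by simp
    qed (use \<open>t \<in> band \<Xi> L x\<close> in \<open>auto simp: band_iff\<close>)
    then show "\<forall>\<xi>\<in>\<Xi>. (\<xi> x < t \<longleftrightarrow> \<xi> \<in> L) \<and> (\<xi> x = t \<longleftrightarrow> \<xi> \<in> {})" by simp
  qed (use assms in \<open>auto simp: band_iff not_less less_le\<close>)
  then show ?thesis unfolding piece_def by blast
qed

text \<open>All members of \<open>M\<close> agree at a point of the piece, and graphs that meet
  coincide, so \<open>M\<close> consists of \<xi> alone. The order of the other graphs relative to
  \<xi> is the same over all of \<open>A\<close>, so no part of the graph is lost.\<close>

lemma piece_graph: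
  assumes A: "cell A" and \<Xi>: "slicing A \<Xi>" and "M \<subseteq> \<Xi>" "\<xi> \<in> M" "piece A \<Xi> L M \<noteq> {}"
  shows "piece A \<Xi> L M = (\<lambda>x. lift x (\<xi> x)) ` A"
proof -
  obtain x0 where x0: "x0 \<in> A" "\<And>\<eta>. \<eta> \<in> \<Xi> \<Longrightarrow> (\<eta> x0 < x0 \<bullet> b \<longleftrightarrow> \<eta> \<in> L) \<and> (\<eta> x0 = x0 \<bullet> b \<longleftrightarrow> \<eta> \<in> M)"
    using assms by (auto simp: piece_def)
  have \<xi>: "\<xi> \<in> \<Xi>" "\<xi> x0 = x0 \<bullet> b" using assms x0 by auto
  have inv: "\<eta> (lift x t) = \<eta> x" if "\<eta> \<in> \<Xi>" "x \<in> A" for \<eta> x t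
  proof -
    have "root_fun A \<eta>" using \<Xi> that(1) by (simp add: slicing_def)
    from root_fun_shift[OF this that(2)] show ?thesis by (simp add: lift_def)
  qed
  have ord: "\<eta> x < \<xi> x \<longleftrightarrow> \<eta> \<in> L" "\<eta> x = \<xi> x \<longleftrightarrow> \<eta> \<in> M" if "\<eta> \<in> \<Xi>" "x \<in> A" for \<eta> x
  proof -
    show "\<eta> x < \<xi> x \<longleftrightarrow> \<eta> \<in> L"
      using slicing_order[OF A \<Xi> that(1) \<xi>(1), of x x0] slicing_order[OF A \<Xi> that(1) \<xi>(1), of x0 x]
        x0(1) x0(2)[OF that(1)] \<xi>(2) that(2) by metis
    show "\<eta> x = \<xi> x \<longleftrightarrow> \<eta> \<in> M"
      using \<Xi> that \<xi> x0(1) x0(2)[OF that(1)] unfolding slicing_def by metis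
  qed
  show ?thesis
  proof (intro equalityI subsetI)
    fix x assume x: "x \<in> piece A \<Xi> L M"
    then have "x \<in> A" "\<xi> x = x \<bullet> b" using \<xi>(1) assms(4) by (auto simp: piece_def)
    then have "x = lift x (\<xi> x)" by (simp add: lift_def)
    then show "x \<in> (\<lambda>x. lift x (\<xi> x)) ` A" using \<open>x \<in> A\<close> by blast
  next
    fix y assume "y \<in> (\<lambda>x. lift x (\<xi> x)) ` A"
    then obtain x where x: "x \<in> A" "y = lift x (\<xi> x)" by blast
    have "(\<eta> y < y \<bullet> b \<longleftrightarrow> \<eta> \<in> L) \<and> (\<eta> y = y \<bullet> b \<longleftrightarrow> \<eta> \<in> M)" if "\<eta> \<in> \<Xi>" for \<eta>
      using inv[OF that x(1), of "\<xi> x"] ord[OF that x(1)] x(2) by simp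
    then show "y \<in> piece A \<Xi> L M"
      using cell_lift[OF A x(1)] x(2) by (simp add: piece_def)
  qed
qed

lemma piece_connected:
  assumes A: "cell A" and \<Xi>: "slicing A \<Xi>" and "L \<subseteq> \<Xi>" "M \<subseteq> \<Xi>" "piece A \<Xi> L M \<noteq> {}"
  shows "connected (piece A \<Xi> L M)"
proof (cases "M = {}")
  case True
  obtain x where "x \<in> A" "x \<bullet> b \<in> band \<Xi> L x" using assms(5) piece_band[OF assms(3)] True by auto
  then show ?thesis using connected_band[OF A \<Xi> assms(3)] piece_band[OF assms(3)] True by auto
next
  case False
  then obtain \<xi> where \<xi>: "\<xi> \<in> M" by blast
  have "continuous_on A \<xi>" using \<Xi> \<xi> assms(4) by (auto simp: slicing_def root_fun_def)
  then have "continuous_on A (\<lambda>x. lift x (\<xi> x))"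
    unfolding lift_def by (intro continuous_intros)
  then show ?thesis
    using piece_graph[OF A \<Xi> assms(4) \<xi> assms(5)] A by (simp add: cell_def connected_continuous_image)
qed

text \<open>The cylindrical property: a nonempty piece projects onto the entire cell, which is
  definable over \<open>R\<close>. Elimination of the new variable rests on this.\<close>

lemma piece_projection:
  assumes A: "cell A" and \<Xi>: "slicing A \<Xi>" and "L \<subseteq> \<Xi>" "M \<subseteq> \<Xi>" "piece A \<Xi> L M \<noteq> {}"
  shows "{x. \<exists>s. x + s *\<^sub>R b \<in> piece A \<Xi> L M} = A"
proof (intro equalityI subsetI)
  fix x assume "x \<in> {x. \<exists>s. x + s *\<^sub>R b \<in> piece A \<Xi> L M}"
  then obtain s where "x + s *\<^sub>R b \<in> A" by (auto simp: piece_def)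
  from cell_translate[OF A this, of "- s"] show "x \<in> A" by simp
next
  fix x assume x: "x \<in> A"
  have "\<exists>t. lift x t \<in> piece A \<Xi> L M"
  proof (cases "M = {}")
    case True
    obtain x0 where "x0 \<in> A" "x0 \<bullet> b \<in> band \<Xi> L x0" using assms(5) piece_band[OF assms(3)] True by auto
    then obtain t where "t \<in> band \<Xi> L x" using band_nonempty[OF A \<Xi> assms(3) _ x] by blast
    then have "lift x t \<in> {x \<in> A. x \<bullet> b \<in> band \<Xi> L x}"
      using cell_lift[OF A x] band_shift[OF \<Xi> assms(3) x] by (simp add: lift_def)
    then show ?thesis using piece_band[OF assms(3)] True by blast
  next
    case False
    then show ?thesis using piece_graph[OF A \<Xi> assms(4) _ assms(5)] x by blast
  qed
  then show "x \<in> {x. \<exists>s. x + s *\<^sub>R b \<in> piece A \<Xi> L M}" by (auto simp: lift_def)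
qed

lemma piece_sa:
  assumes A: "cell A" and \<Xi>: "slicing A \<Xi>"
  shows "sa_over R' (piece A \<Xi> L M)"
proof -
  have saA: "sa_over R' A"
    using A sa_over_mono[OF _ subset_adjoin[OF function_ring_axioms]] by (simp add: cell_def)
  define lo where "lo \<xi> = {x\<in>A. \<xi> x < x \<bullet> b}" for \<xi>
  define hi where "hi \<xi> = {x\<in>A. x \<bullet> b < \<xi> x}" for \<xi>
  have lohi: "sa_over R' (lo \<xi>)" "sa_over R' (hi \<xi>)" if "\<xi> \<in> \<Xi>" for \<xi>
    using \<Xi> that by (auto simp: slicing_def root_fun_def lo_def hi_def)
  have "piece A \<Xi> L M = A \<inter> (\<Inter>\<xi>\<in>\<Xi>. (if \<xi> \<in> L then lo \<xi> else A - lo \<xi>) \<inter>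
      (if \<xi> \<in> M then A - (lo \<xi> \<union> hi \<xi>) else lo \<xi> \<union> hi \<xi>))" (is "?l = ?r")
  proof (rule set_eqI)
    fix x show "x \<in> ?l \<longleftrightarrow> x \<in> ?r"
    proof (cases "x \<in> A")
      case True
      have "((\<xi> x < x \<bullet> b \<longleftrightarrow> \<xi> \<in> L) \<and> (\<xi> x = x \<bullet> b \<longleftrightarrow> \<xi> \<in> M)) \<longleftrightarrow> 
        x \<in> (if \<xi> \<in> L then lo \<xi> else A - lo \<xi>) \<inter> (if \<xi> \<in> M then A - (lo \<xi> \<union> hi \<xi>) else lo \<xi> \<union> hi \<xi>)" for \<xi>
        using True by (auto simp: lo_def hi_def)
      then show ?thesis using True by (simp add: piece_def)
    qed (simp add: piece_def)
  qed
  moreover have "sa_over R' \<dots>"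
    using \<Xi> lohi saA by (auto simp: slicing_def intro!: sa_over_Int sa_over_INT sa_over_Diff sa_over_Un)
  ultimately show ?thesis by simp
qed

lemma piece_sgn:
  assumes A: "cell A" and \<Xi>: "slicing A \<Xi>" and "L \<subseteq> \<Xi>" "M \<subseteq> \<Xi>" and q: "sliced A \<Xi> q" "pfun A N q"
    and x: "x \<in> piece A \<Xi> L M" and y: "y \<in> piece A \<Xi> L M"
  shows "sgn (poly (q x) (x \<bullet> b)) = sgn (poly (q y) (y \<bullet> b))"
proof (cases "M = {}")
  case True
  then show ?thesis using x y sliced_sign_on_band(1)[OF A \<Xi> q assms(3)] piece_band[OF assms(3)] by auto
next
  case False
  then obtain \<xi> where "\<xi> \<in> M" "\<xi> \<in> \<Xi>" using assms(4) by blast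
  moreover from this have "\<xi> x = x \<bullet> b" "\<xi> y = y \<bullet> b" "x \<in> A" "y \<in> A"
    using x y unfolding piece_def by blast+
  ultimately show ?thesis using sliced_root_sgn[OF A \<Xi> q(2,1)] by metis
qed

lemma adjoin_decomposition:
  assumes "finite Q" "Q \<subseteq> R'"
  obtains \<C> where "finite \<C>" "\<Union>\<C> = UNIV"
    "\<And>C. C \<in> \<C> \<Longrightarrow> connected C \<and> C \<noteq> {} \<and> sa_over R' C \<and> sa_over R {x. \<exists>s. x + s *\<^sub>R b \<in> C}"
    "\<And>C x y. C \<in> \<C> \<Longrightarrow> x \<in> C \<Longrightarrow> y \<in> C \<Longrightarrow> same_signs Q x y"
proof -
  have "\<forall>q\<in>Q. \<exists>P. (\<exists>N. pfun UNIV N P) \<and> (\<forall>x. q x = poly (P x) (x \<bullet> b))"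
  proof
    fix q assume "q \<in> Q"
    then have "q \<in> R'" using assms(2) by blast
    then obtain P N where P: "\<And>i. (\<lambda>x. coeff (P x) i) \<in> R" "\<And>x. degree (P x) \<le> N"
       "\<And>x. q x = poly (P x) (x \<bullet> b)" by (rule adjoinE) blast
    have "pfun UNIV N P" unfolding pfun_def
      using P by (intro conjI allI) (rule_tac x = "\<lambda>x. coeff (P x) i" in bexI, auto)
    then show "\<exists>P. (\<exists>N. pfun UNIV N P) \<and> (\<forall>x. q x = poly (P x) (x \<bullet> b))" using P(3) by blast
  qed
  then obtain P where "\<forall>q\<in>Q. (\<exists>N. pfun UNIV N (P q)) \<and> (\<forall>x. q x = poly (P q x) (x \<bullet> b))"
    by (rule bchoice[THEN exE])
  then obtain N where P: "\<And>q. q \<in> Q \<Longrightarrow> pfun UNIV (N q) (P q)" "\<And>q x. q \<in> Q \<Longrightarrow> q x = poly (P q x) (x \<bullet> b)"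
    by metis
  define d where "d = (\<Sum>q\<in>Q. N q)"
  have Pd: "pfun UNIV d (P q)" if "q \<in> Q" for q
    using P(1)[OF that] by (rule pfun_mono) (use assms(1) that in \<open>auto simp: d_def intro: member_le_sum\<close>)
  have "sliceable UNIV (P ` Q)"
    by (rule slicing_exists[OF cell_UNIV, of _ d]) (use assms(1) Pd in auto)
  then obtain \<A> where \<A>: "finite \<A>" "\<Union>\<A> = UNIV" "\<And>A. A \<in> \<A> \<Longrightarrow> cell A"
    "\<forall>A\<in>\<A>. \<exists>\<Xi>. slicing A \<Xi> \<and> (\<forall>P\<in>P ` Q. sliced A \<Xi> P)"
    unfolding sliceable_def by metis
  from \<A>(4) obtain \<Xi> where \<Xi>: "\<forall>A\<in>\<A>. slicing A (\<Xi> A) \<and> (\<forall>P\<in>P ` Q. sliced A (\<Xi> A) P)"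
    by (rule bchoice[THEN exE])
  \<comment> \<open>All pairs of subsets are tried; those that describe no actual position relative
    to the graphs give the empty set, which is removed because cells are nonempty.\<close>
  define \<C> where "\<C> = (\<Union>A\<in>\<A>. (\<lambda>(L, M). piece A (\<Xi> A) L M) ` (Pow (\<Xi> A) \<times> Pow (\<Xi> A))) - {{}}"
  have \<C>E: "\<exists>A L M. A \<in> \<A> \<and> L \<subseteq> \<Xi> A \<and> M \<subseteq> \<Xi> A \<and> C = piece A (\<Xi> A) L M \<and> C \<noteq> {}" if "C \<in> \<C>" for C
  proof -
    have "\<exists>A\<in>\<A>. C \<in> (\<lambda>(L, M). piece A (\<Xi> A) L M) ` (Pow (\<Xi> A) \<times> Pow (\<Xi> A))" and ne: "C \<noteq> {}"
      using that unfolding \<C>_def by (simp_all only: Diff_iff UN_iff singleton_iff not_False_eq_True)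
    then obtain A where A: "A \<in> \<A>" "C \<in> (\<lambda>(L, M). piece A (\<Xi> A) L M) ` (Pow (\<Xi> A) \<times> Pow (\<Xi> A))" by blast
    from A(2) obtain a where "C = (\<lambda>(L, M). piece A (\<Xi> A) L M) a" "a \<in> Pow (\<Xi> A) \<times> Pow (\<Xi> A)" by (rule imageE)
    then show ?thesis using A(1) ne by (intro exI[of _ A] exI[of _ "fst a"] exI[of _ "snd a"]) auto
  qed
  show ?thesis
  proof (rule that[of \<C>])
    show "finite \<C>" using \<A>(1) \<Xi> by (auto simp: \<C>_def slicing_def)
    have "\<exists>C\<in>\<C>. x \<in> C" for x
    proof -
      obtain A where A: "A \<in> \<A>" "x \<in> A" using \<A>(2) by blast
      let ?L = "{\<xi>\<in>\<Xi> A. \<xi> x < x \<bullet> b}" and ?M = "{\<xi>\<in>\<Xi> A. \<xi> x = x \<bullet> b}"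
      have "x \<in> piece A (\<Xi> A) ?L ?M" using A(2) by (simp add: piece_def)
      moreover have "piece A (\<Xi> A) ?L ?M \<in> (\<lambda>(L, M). piece A (\<Xi> A) L M) ` (Pow (\<Xi> A) \<times> Pow (\<Xi> A))"
        by (rule image_eqI[of _ _ "(?L, ?M)"]) auto
      ultimately have "piece A (\<Xi> A) ?L ?M \<in> \<C>"
        unfolding \<C>_def by (intro DiffI UN_I[OF A(1)]) (assumption, auto)
      then show ?thesis using \<open>x \<in> piece A (\<Xi> A) ?L ?M\<close> by (rule bexI[rotated])
    qed
    then show "\<Union>\<C> = UNIV" by blast
    fix C assume "C \<in> \<C>"
    then obtain A L M where C: "A \<in> \<A>" "L \<subseteq> \<Xi> A" "M \<subseteq> \<Xi> A" "C = piece A (\<Xi> A) L M" "C \<noteq> {}"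
      using \<C>E by blast
    have A: "cell A" and \<Xi>A: "slicing A (\<Xi> A)" using \<A>(3) \<Xi> C(1) by blast+
    show "connected C \<and> C \<noteq> {} \<and> sa_over R' C \<and> sa_over R {x. \<exists>s. x + s *\<^sub>R b \<in> C}"
      using piece_connected[OF A \<Xi>A C(2,3)] piece_sa[OF A \<Xi>A] piece_projection[OF A \<Xi>A C(2,3)] C(4,5) A
      by (simp add: cell_def)
    fix x y assume xy: "x \<in> C" "y \<in> C"
    show "same_signs Q x y" unfolding same_signs_def
    proof
      fix q assume q: "q \<in> Q"
      have "sliced A (\<Xi> A) (P q)" using \<Xi> C(1) q by blast
      moreover have "pfun A d (P q)" using pfun_mono[OF Pd[OF q]] by simp
      ultimately show "sgn (q x) = sgn (q y)"
        using piece_sgn[OF A \<Xi>A C(2,3)] xy C(4) P(2)[OF q] by metis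
    qed
  qed
qed

lemma cell_dec_adjoin: "cell_dec R'"
  unfolding cell_dec_def using adjoin_decomposition by metis

text \<open>\<open>S\<close> is the union of the pieces that it contains, and projection commutes
  with unions.\<close>

lemma sa_over_projection:
  assumes "sa_over R' S"
  shows "sa_over R {x. \<exists>s. x + s *\<^sub>R b \<in> S}"
proof -
  obtain Q where Q: "finite Q" "Q \<subseteq> R'" "\<And>x y. same_signs Q x y \<Longrightarrow> x \<in> S \<Longrightarrow> y \<in> S"
    using assms unfolding sa_over_def by blast
  obtain \<C> where \<C>: "finite \<C>" "\<Union>\<C> = UNIV"
    "\<And>C. C \<in> \<C> \<Longrightarrow> connected C \<and> C \<noteq> {} \<and> sa_over R' C \<and> sa_over R {x. \<exists>s. x + s *\<^sub>R b \<in> C}"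
    "\<And>C x y. C \<in> \<C> \<Longrightarrow> x \<in> C \<Longrightarrow> y \<in> C \<Longrightarrow> same_signs Q x y"
    using adjoin_decomposition[OF Q(1,2)] by blast
  have "\<exists>C\<in>\<C>. C \<subseteq> S \<and> x \<in> C" if "x \<in> S" for x
    using that \<C>(2,4) Q(3) by (metis UNIV_I UnionE subsetI)
  then have "{x. \<exists>s. x + s *\<^sub>R b \<in> S} = (\<Union>C\<in>{C\<in>\<C>. C \<subseteq> S}. {x. \<exists>s. x + s *\<^sub>R b \<in> C})" by blast
  moreover have "sa_over R \<dots>" using \<C>(1,3) by (intro sa_over_UN) auto
  ultimately show ?thesis by simp
qed

end

section \<open>Tarski--Seidenberg and adapted decompositions\<close>

text \<open>The order of the list is the order of elimination: the head is the coordinate projected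
  out first. Any coordinate can be eliminated by listing it at the head.\<close>

primrec polys_in :: "'a::euclidean_space list \<Rightarrow> ('a \<Rightarrow> real) set" where
  "polys_in [] = range (\<lambda>c _. c)"
| "polys_in (b # bs) = adjoin b (polys_in bs)"

lemma function_ring_polys_in: "function_ring (polys_in bs)"
proof (induction bs)
  case Nil
  show ?case by unfold_locales (auto simp: image_iff fun_eq_iff)
next
  case (Cons b bs)
  then show ?case using function_ring_adjoin by simp
qed

lemma coordinate_in_polys_in: "c \<in> set bs \<Longrightarrow> (\<lambda>x. x \<bullet> c) \<in> polys_in bs"
proof (induction bs)
  case (Cons b bs)
  then show ?case
    using coordinate_in_adjoin[OF function_ring_polys_in, of b bs] subset_adjoin[OF function_ring_polys_in, of bs b]
    by auto
qed simp

lemma polys_in_real_polynomial: "f \<in> polys_in bs \<Longrightarrow> real_polynomial_function f"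
proof (induction bs arbitrary: f)
  case (Cons b bs)
  from Cons.prems have "f \<in> adjoin b (polys_in bs)" by simp
  then obtain P N where P: "\<And>i. (\<lambda>x. coeff (P x) i) \<in> polys_in bs" "\<And>x. degree (P x) \<le> N"
    "\<And>x. f x = poly (P x) (x \<bullet> b)" by (rule adjoinE) blast
  have "f x = (\<Sum>i\<le>N. coeff (P x) i * (x \<bullet> b) ^ i)" for x
  proof -
    have "poly (P x) (x \<bullet> b) = poly (\<Sum>i\<le>N. monom (coeff (P x) i) i) (x \<bullet> b)"
      using P(2) by (simp add: poly_as_sum_of_monoms')
    then show ?thesis using P(3) by (simp add: poly_sum poly_monom)
  qed
  moreover have "real_polynomial_function (\<lambda>x. \<Sum>i\<le>N. coeff (P x) i * (x \<bullet> b) ^ i)"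
    by (intro real_polynomial_function_sum real_polynomial_function.intros(4) real_polynomial_function_power
        real_polynomial_function.intros(1)[OF bounded_linear_inner_left] Cons.IH[OF P(1)]) auto
  ultimately show ?case by (simp add: fun_eq_iff cong: arg_cong[where f = real_polynomial_function] flip: fun_eq_iff)
qed auto

lemma polys_in_shift:
  assumes "b \<in> Basis" "set bs \<subseteq> Basis" "b \<notin> set bs" "f \<in> polys_in bs"
  shows "f (x + s *\<^sub>R b) = f x"
  using assms(2-4)
proof (induction bs arbitrary: f)
  case (Cons c bs)
  from Cons.prems have "f \<in> adjoin c (polys_in bs)" by simp
  then obtain P where P: "\<And>i. (\<lambda>x. coeff (P x) i) \<in> polys_in bs" "\<And>x. f x = poly (P x) (x \<bullet> c)"
    by (rule adjoinE) blast
  have "P (x + s *\<^sub>R b) = P x"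
    using Cons.IH[OF _ _ P(1)] Cons.prems by (intro poly_eqI) simp
  moreover have "b \<bullet> c = 0" using Cons.prems assms(1) by (simp add: inner_Basis)
  ultimately show ?case using P(2) by (simp add: inner_add_left)
qed auto

lemma poly_extension_polys_in:
  assumes "set bs \<subseteq> Basis" "distinct bs" "b \<in> Basis" "b \<notin> set bs" "cell_dec (polys_in bs)"
  shows "poly_extension (polys_in bs) b"
proof (intro poly_extension.intro poly_extension_axioms.intro function_ring_polys_in)
  show "continuous_on UNIV f" if "f \<in> polys_in bs" for f
    using polys_in_real_polynomial[OF that] continuous_on_polymonial_function
    by (simp add: real_polynomial_function_eq)
qed (use assms polys_in_shift in auto)

lemma cell_dec_polys_in: "set bs \<subseteq> Basis \<Longrightarrow> distinct bs \<Longrightarrow> cell_dec (polys_in bs)"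
proof (induction bs)
  case Nil
  have "same_signs Q x y" if "Q \<subseteq> range (\<lambda>c _. c)" for Q :: "('a \<Rightarrow> real) set" and x y
    using that by (auto simp: same_signs_def)
  then show ?case unfolding cell_dec_def
    by (intro allI impI exI[of _ "{UNIV}"]) (auto simp: convex_connected)
next
  case (Cons b bs)
  then interpret poly_extension "polys_in bs" b by (intro poly_extension_polys_in) auto
  show ?case using cell_dec_adjoin by simp
qed

lemma polys_in_Basis:
  assumes "set bs = Basis"
  shows "polys_in bs = {f. real_polynomial_function f}"
proof
  interpret function_ring "polys_in bs" by (rule function_ring_polys_in)
  show "{f. real_polynomial_function f} \<subseteq> polys_in bs"
  proof (safe)
    fix f :: "'a \<Rightarrow> real" assume "real_polynomial_function f"
    then show "f \<in> polys_in bs"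
    proof (induction f rule: real_polynomial_function.induct)
      case (linear f)
      have "f x = (\<Sum>b\<in>Basis. f b * (x \<bullet> b))" for x
      proof -
        have "f x = f (\<Sum>b\<in>Basis. (x \<bullet> b) *\<^sub>R b)" by (simp add: euclidean_representation)
        then show ?thesis
          using linear by (simp add: bounded_linear.linear linear_sum linear_scale mult.commute)
      qed
      then have "f = (\<lambda>x. \<Sum>b\<in>Basis. f b * (x \<bullet> b))" by blast
      moreover have "(\<lambda>x. \<Sum>b\<in>Basis. f b * (x \<bullet> b)) \<in> polys_in bs"
        using assms by (intro sum mult const coordinate_in_polys_in) auto
      ultimately show ?case by simp
    qed (auto intro: const add mult)
  qed
qed (use polys_in_real_polynomial in blast)

text \<open>From right to left: \<open>S\<close> is the union of the sign classes of
  \<open>Q\<close> that it meets. Each class is basic, and only finitely many sign vectors on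
  \<open>Q\<close> exist.\<close>

lemma semialgebraic_iff_sa_over:
  "semialgebraic (S :: 'a::euclidean_space set) \<longleftrightarrow> sa_over {f. real_polynomial_function f} S" (is "_ \<longleftrightarrow> sa_over ?R S")
proof
  have "sa_over ?R B" if "basic_semialgebraic B" for B :: "'a set"
  proof -
    obtain P Q where B: "finite P" "finite Q" "\<forall>p\<in>P \<union> Q. real_polynomial_function p"
        "B = {x. (\<forall>p\<in>P. p x = 0) \<and> (\<forall>q\<in>Q. q x > 0)}"
      using \<open>basic_semialgebraic B\<close> unfolding basic_semialgebraic_def by blast
    have "y \<in> B" if "same_signs (P \<union> Q) x y" "x \<in> B" for x y
    proof -
      have "p y = 0" if "p \<in> P" for p
        using that \<open>same_signs (P \<union> Q) x y\<close> \<open>x \<in> B\<close> B(4) unfolding same_signs_def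
        by (metis (mono_tags, lifting) UnI1 mem_Collect_eq sgn_0 sgn_zero_iff)
      moreover have "q y > 0" if "q \<in> Q" for q
        using that \<open>same_signs (P \<union> Q) x y\<close> \<open>x \<in> B\<close> B(4) unfolding same_signs_def
        by (metis (mono_tags, lifting) UnI2 mem_Collect_eq sgn_1_pos)
      ultimately show ?thesis using B(4) by blast
    qed
    then show ?thesis unfolding sa_over_def using B by (intro exI[of _ "P \<union> Q"]) auto
  qed
  moreover assume "semialgebraic S"
  then obtain F where "finite F" "\<And>B. B \<in> F \<Longrightarrow> basic_semialgebraic B" "S = \<Union>F" by (auto simp: semialgebraic_def)
  ultimately show "sa_over ?R S" using sa_over_UN[of F ?R "\<lambda>B. B"] by simp
next
  assume "sa_over ?R S"
  then obtain Q where Q: "finite Q" "Q \<subseteq> ?R" "\<And>x y. same_signs Q x y \<Longrightarrow> x \<in> S \<Longrightarrow> y \<in> S"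
    unfolding sa_over_def by blast
  define sv where "sv x = restrict (\<lambda>q. sgn (q x)) Q" for x :: 'a
  define C where "C \<sigma> = {y. \<forall>q\<in>Q. sgn (q y) = \<sigma> q}" for \<sigma> :: "('a \<Rightarrow> real) \<Rightarrow> real"
  have "sv ` S \<subseteq> Q \<rightarrow>\<^sub>E {-1, 0, 1}" by (auto simp: sv_def sgn_real_def split: if_splits)
  moreover have "finite (Q \<rightarrow>\<^sub>E {-1, 0, 1 :: real})" using Q(1) by (intro finite_PiE) auto
  ultimately have fin: "finite (sv ` S)" by (rule finite_subset)
  have C_sv: "y \<in> C (sv x) \<longleftrightarrow> same_signs Q x y" for x y
    by (auto simp: C_def sv_def same_signs_def)
  have "basic_semialgebraic (C (sv x))" for x
    unfolding basic_semialgebraic_def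
  proof (intro exI conjI)
    \<comment> \<open>The factor \<open>sgn (q x)\<close> turns a condition \<open>q y < 0\<close>
      into a positivity condition.\<close>
    let ?P = "{q\<in>Q. sgn (q x) = 0}" and ?N = "(\<lambda>q y. sgn (q x) * q y) ` {q\<in>Q. sgn (q x) \<noteq> 0}"
    show "finite ?P" "finite ?N" using Q(1) by auto
    show "\<forall>p\<in>?P \<union> ?N. real_polynomial_function p" using Q(2) by auto
    have "sgn (q y) = sgn (q x) \<longleftrightarrow> (if sgn (q x) = 0 then q y = 0 else sgn (q x) * q y > 0)" for q :: "'a \<Rightarrow> real" and y
      by (auto simp: sgn_real_def)
    then show "C (sv x) = {y. (\<forall>p\<in>?P. p y = 0) \<and> (\<forall>q\<in>?N. q y > 0)}"
      by (auto simp: C_def sv_def)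
  qed
  moreover have "S = \<Union>(C ` sv ` S)"
  proof (intro equalityI subsetI)
    fix x assume "x \<in> S"
    then show "x \<in> \<Union>(C ` sv ` S)" using C_sv[of x x] by (auto simp: same_signs_def)
  next
    fix y assume "y \<in> \<Union>(C ` sv ` S)"
    then show "y \<in> S" using C_sv Q(3) by auto
  qed
  ultimately show "semialgebraic S"
    unfolding semialgebraic_def using fin by (intro exI[of _ "C ` sv ` S"]) auto
qed

section \<open>Closure properties of semialgebraic sets\<close>

lemma semialgebraic_Int: "semialgebraic S \<Longrightarrow> semialgebraic T \<Longrightarrow> semialgebraic (S \<inter> T)"
  by (simp add: semialgebraic_iff_sa_over sa_over_Int)

lemma semialgebraic_UN:
  "finite I \<Longrightarrow> (\<And>i. i \<in> I \<Longrightarrow> semialgebraic (S i)) \<Longrightarrow> semialgebraic (\<Union>i\<in>I. S i)"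
  by (simp add: semialgebraic_iff_sa_over sa_over_UN)

lemma semialgebraic_pos: "real_polynomial_function p \<Longrightarrow> semialgebraic {x. p x > 0}"
  by (simp add: semialgebraic_iff_sa_over sa_over_pos)

lemma semialgebraic_vimage:
  fixes g :: "'a::euclidean_space \<Rightarrow> 'b::euclidean_space"
  assumes "semialgebraic S" "polynomial_function g"
  shows "semialgebraic (g -` S)"
proof -
  obtain Q where Q: "finite Q" "\<And>q. q \<in> Q \<Longrightarrow> real_polynomial_function q"
     "\<And>x y. same_signs Q x y \<Longrightarrow> x \<in> S \<Longrightarrow> y \<in> S"
    using assms(1) unfolding semialgebraic_iff_sa_over sa_over_def by blast
  have "y \<in> g -` S" if "same_signs ((\<lambda>q. q \<circ> g) ` Q) x y" "x \<in> g -` S" for x y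
    using that Q(3)[of "g x" "g y"] by (simp add: same_signs_def)
  then show ?thesis
    unfolding semialgebraic_iff_sa_over sa_over_def
    using Q(1,2) assms(2) by (intro exI[of _ "(\<lambda>q. q \<circ> g) ` Q"]) (auto simp: real_polynomial_function_compose)
qed

lemma semialgebraic_projection:
  fixes S :: "'a::euclidean_space set"
  assumes "semialgebraic S" "b \<in> Basis"
  shows "semialgebraic {x. \<exists>s. x + s *\<^sub>R b \<in> S}"
proof -
  obtain bs where bs: "set bs = Basis - {b}" "distinct bs"
    using finite_distinct_list[of "Basis - {b}"] by auto
  then interpret poly_extension "polys_in bs" b
    using assms(2) by (intro poly_extension_polys_in cell_dec_polys_in) auto
  have "sa_over (polys_in (b # bs)) S"
    using assms bs by (subst polys_in_Basis) (auto simp: semialgebraic_iff_sa_over)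
  then have "sa_over (polys_in bs) {x. \<exists>s. x + s *\<^sub>R b \<in> S}"
    using sa_over_projection by simp
  then show ?thesis
    unfolding semialgebraic_iff_sa_over by (rule sa_over_mono) (use polys_in_real_polynomial in blast)
qed

text \<open>Projecting along \<open>(0, 1)\<close> gives a cylinder in the product space; its
  section at height 0 is the image in the factor.\<close>

lemma semialgebraic_fst_image:
  fixes S :: "('a::euclidean_space \<times> real) set"
  assumes "semialgebraic S"
  shows "semialgebraic (fst ` S)"
proof -
  have "fst ` S = (\<lambda>x. (x, 0)) -` {z. \<exists>s. z + s *\<^sub>R (0, 1) \<in> S}"
    by (auto simp: image_iff) force
  moreover have "(0, 1) \<in> (Basis :: ('a \<times> real) set)" by (simp add: Basis_prod_def)
  note semialgebraic_projection[OF assms this]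
  moreover have "polynomial_function (\<lambda>x::'a. (x, 0 :: real))"
    by (intro polynomial_function_bounded_linear bounded_linear_Pair bounded_linear_ident bounded_linear_zero)
  ultimately show ?thesis by (simp only: semialgebraic_vimage)
qed

text \<open>\<open>f\<close> and \<open>g\<close> are known only through their graphs. Both values
  are therefore adjoined as extra coordinates, compared by a polynomial inequality, and projected
  away again.\<close>

lemma semialgebraic_less:
  fixes f g :: "'a::euclidean_space \<Rightarrow> real"
  assumes "semialgebraic_fun_on X f" "semialgebraic_fun_on X g"
  shows "semialgebraic {x \<in> X. f x < g x}"
proof -
  define T :: "(('a \<times> real) \<times> real) set" where
    "T = (fst -` ((\<lambda>x. (x, f x)) ` X) \<inter> (\<lambda>z. (fst (fst z), snd z)) -` ((\<lambda>x. (x, g x)) ` X)) \<inter>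
       {z. snd z - snd (fst z) > 0}"
  have lin: "bounded_linear (\<lambda>z::('a \<times> real) \<times> real. fst z)" "bounded_linear (\<lambda>z::('a \<times> real) \<times> real. snd z)"
    "bounded_linear (\<lambda>z::('a \<times> real) \<times> real. fst (fst z))" "bounded_linear (\<lambda>z::('a \<times> real) \<times> real. snd (fst z))"
    by (intro bounded_linear_fst bounded_linear_snd bounded_linear_fst_comp bounded_linear_snd_comp bounded_linear_ident)+
  have "semialgebraic T"
    unfolding T_def using assms lin
    by (intro semialgebraic_Int semialgebraic_vimage semialgebraic_pos real_polynomial_function_diff
        polynomial_function_bounded_linear bounded_linear_Pair)
       (auto simp: semialgebraic_fun_on_def)
  then have "semialgebraic (fst ` fst ` T)" by (intro semialgebraic_fst_image)
  moreover have "fst ` fst ` T = {x \<in> X. f x < g x}"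
  proof (intro equalityI subsetI)
    fix x assume "x \<in> {x \<in> X. f x < g x}"
    then have "((x, f x), g x) \<in> T" by (auto simp: T_def)
    then show "x \<in> fst ` fst ` T" by force
  qed (auto simp: T_def)
  ultimately show ?thesis by simp
qed

lemma semialgebraic_adapted_cells:
  fixes \<S> :: "'a::euclidean_space set set"
  assumes "finite \<S>" "\<And>S. S \<in> \<S> \<Longrightarrow> semialgebraic S"
  shows "\<exists>\<C>. finite \<C> \<and> \<Union>\<C> = UNIV \<and>
    (\<forall>C\<in>\<C>. connected C \<and> C \<noteq> {} \<and> semialgebraic C \<and> (\<forall>S\<in>\<S>. C \<subseteq> S \<or> C \<inter> S = {}))"
proof -
  let ?R = "{f. real_polynomial_function (f :: 'a \<Rightarrow> real)}"
  obtain bs :: "'a list" where "set bs = Basis" "distinct bs" using finite_distinct_list finite_Basis by blast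
  then have dec: "cell_dec ?R" using cell_dec_polys_in[of bs] polys_in_Basis[of bs] by simp
  have "\<forall>S\<in>\<S>. \<exists>Q. finite Q \<and> Q \<subseteq> ?R \<and> (\<forall>x y. same_signs Q x y \<longrightarrow> x \<in> S \<longrightarrow> y \<in> S)"
    using assms(2) by (simp add: semialgebraic_iff_sa_over sa_over_def)
  then obtain Q where Q: "\<forall>S\<in>\<S>. finite (Q S) \<and> Q S \<subseteq> ?R \<and> (\<forall>x y. same_signs (Q S) x y \<longrightarrow> x \<in> S \<longrightarrow> y \<in> S)"
    by (rule bchoice[THEN exE])
  have "finite (\<Union>S\<in>\<S>. Q S)" "(\<Union>S\<in>\<S>. Q S) \<subseteq> ?R" using Q assms(1) by auto
  then obtain \<C> where \<C>: "finite \<C>" "\<Union>\<C> = UNIV"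
     "\<forall>C\<in>\<C>. connected C \<and> C \<noteq> {} \<and> sa_over ?R C \<and> (\<forall>x\<in>C. \<forall>y\<in>C. same_signs (\<Union>S\<in>\<S>. Q S) x y)"
    using dec unfolding cell_dec_def by metis
  show ?thesis
  proof (intro exI[of _ \<C>] conjI ballI \<C>(1,2))
    show "connected C" "C \<noteq> {}" "semialgebraic C" if "C \<in> \<C>" for C
      using \<C>(3) that by (simp_all add: semialgebraic_iff_sa_over)
    fix C S assume "C \<in> \<C>" "S \<in> \<S>"
    have "y \<in> S" if "x \<in> C" "x \<in> S" "y \<in> C" for x y
    proof -
      have "same_signs (\<Union>S\<in>\<S>. Q S) x y" using \<C>(3) \<open>C \<in> \<C>\<close> that by blast
      then have "same_signs (Q S) x y" using \<open>S \<in> \<S>\<close> by (auto simp: same_signs_def)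
      then show ?thesis using Q \<open>S \<in> \<S>\<close> that by blast
    qed
    then show "C \<subseteq> S \<or> C \<inter> S = {}" by blast
  qed
qed

section \<open>Continuous selections\<close>

text \<open>Where \<open>g\<close> differs from \<open>f i\<close> it equals some \<open>f j\<close>
  that differs from \<open>f i\<close> on all of \<open>C\<close>. Finitely many closed sets thus
  make up the complement of the closed set where \<open>g\<close> equals \<open>f i\<close>, which
  is therefore open as well.\<close>

lemma selection_on_connected:
  fixes f :: "nat \<Rightarrow> 'a::topological_space \<Rightarrow> real"
  assumes C: "connected C" "C \<noteq> {}" and I: "finite I" and f: "\<And>i. i \<in> I \<Longrightarrow> continuous_on C (f i)"
    and g: "continuous_on C g" "\<And>x. x \<in> C \<Longrightarrow> \<exists>i\<in>I. g x = f i x"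
    and eq: "\<And>i j. i \<in> I \<Longrightarrow> j \<in> I \<Longrightarrow> (\<forall>x\<in>C. f i x = f j x) \<or> (\<forall>x\<in>C. f i x \<noteq> f j x)"
  shows "\<exists>i\<in>I. \<forall>x\<in>C. g x = f i x"
proof -
  obtain x0 i where x0: "x0 \<in> C" "i \<in> I" "g x0 = f i x0" using C(2) g(2) by blast
  define J where "J = {j\<in>I. \<forall>x\<in>C. f i x \<noteq> f j x}"
  have cl: "closedin (top_of_set C) {x\<in>C. g x = f j x}" if "j \<in> I" for j
  proof -
    have "closedin (top_of_set C) (C \<inter> (\<lambda>x. g x - f j x) -` {0})"
      by (intro continuous_closedin_preimage continuous_intros g f that)
    moreover have "C \<inter> (\<lambda>x. g x - f j x) -` {0} = {x\<in>C. g x = f j x}" by auto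
    ultimately show ?thesis by simp
  qed
  have "closedin (top_of_set C) (\<Union>j\<in>J. {x\<in>C. g x = f j x})"
    using I cl by (intro closedin_Union) (auto simp: J_def)
  then have "openin (top_of_set C) (C - (\<Union>j\<in>J. {x\<in>C. g x = f j x}))" by (intro openin_diff) auto
  moreover have "C - (\<Union>j\<in>J. {x\<in>C. g x = f j x}) = {x\<in>C. g x = f i x}"
  proof -
    have "g x = f i x \<longleftrightarrow> (\<forall>j\<in>J. g x \<noteq> f j x)" if "x \<in> C" for x
    proof
      assume "\<forall>j\<in>J. g x \<noteq> f j x"
      moreover obtain j where j: "j \<in> I" "g x = f j x" using g(2) \<open>x \<in> C\<close> by blast
      ultimately have "\<not> (\<forall>x\<in>C. f i x \<noteq> f j x)" by (auto simp: J_def)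
      then show "g x = f i x" using eq[OF x0(2) j(1)] j(2) \<open>x \<in> C\<close> by auto
    qed (use that in \<open>auto simp: J_def\<close>)
    then show ?thesis by blast
  qed
  moreover have "openin (top_of_set C) {x\<in>C. g x \<noteq> f i x}"
  proof -
    have "C - {x\<in>C. g x = f i x} = {x\<in>C. g x \<noteq> f i x}" by blast
    then show ?thesis using cl[OF x0(2)] by (metis openin_diff openin_subtopology_self)
  qed
  ultimately have "g y = f i y" if "y \<in> C" for y
    using connected_locally_constant[OF C(1) x0(1) that, of "\<lambda>x. g x = f i x"] x0(3) by simp
  then show ?thesis using x0(2) by blast
qed

theorem theorem3p1:
  fixes X :: "(real ^ 'n) set"
    and f :: "nat \<Rightarrow> real ^ 'n \<Rightarrow> real"
    and r :: nat
  assumes "semialgebraic X"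
    and "\<And>i. i \<in> {1..r} \<Longrightarrow> continuous_on X (f i)"
    and "\<And>i. i \<in> {1..r} \<Longrightarrow> semialgebraic_fun_on X (f i)"
  shows "finite (continuous_selections r f X) \<and>
         (\<forall>g\<in>continuous_selections r f X. semialgebraic_fun_on X g)"
proof -
  let ?I = "{1..r}"
  define less where "less i j = {x\<in>X. f i x < f j x}" for i j
  \<comment> \<open>Both \<open>less i j\<close> and \<open>less j i\<close> are included: on a cell
    inside \<open>X\<close> each holds everywhere or nowhere, and if neither holds, then
    \<open>f i\<close> and \<open>f j\<close> are equal.\<close>
  define \<S> where "\<S> = insert X ((\<lambda>(i, j). less i j) ` (?I \<times> ?I))"
  have fin\<S>: "finite \<S>" by (simp add: \<S>_def)
  have sa\<S>: "semialgebraic S" if "S \<in> \<S>" for S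
    using that assms(1) semialgebraic_less[OF assms(3) assms(3)] by (auto simp: less_def \<S>_def)
  obtain \<C> where \<C>: "finite \<C>" "\<Union>\<C> = UNIV"
    "\<And>C. C \<in> \<C> \<Longrightarrow> connected C \<and> C \<noteq> {} \<and> semialgebraic C"
    "\<And>C S. C \<in> \<C> \<Longrightarrow> S \<in> \<S> \<Longrightarrow> C \<subseteq> S \<or> C \<inter> S = {}"
    using semialgebraic_adapted_cells[OF fin\<S> sa\<S>] by metis
  define \<D> where "\<D> = {C\<in>\<C>. C \<subseteq> X}"
  have fin\<D>: "finite \<D>" using \<C>(1) by (simp add: \<D>_def)
  have X: "\<exists>C\<in>\<D>. x \<in> C" if "x \<in> X" for x
  proof -
    obtain C where "C \<in> \<C>" "x \<in> C" using \<C>(2) by blast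
    then show ?thesis using \<C>(4)[of C X] that by (auto simp: \<D>_def \<S>_def)
  qed
  have sel: "\<exists>i\<in>?I. \<forall>x\<in>C. g x = f i x" if g: "g \<in> continuous_selections r f X" and C: "C \<in> \<D>" for g C
  proof (rule selection_on_connected)
    have CX: "C \<in> \<C>" "C \<subseteq> X" using C by (auto simp: \<D>_def)
    show "connected C" "C \<noteq> {}" using \<C>(3) CX by auto
    show "continuous_on C (f i)" if "i \<in> ?I" for i using assms(2)[OF that] CX(2) continuous_on_subset by blast
    show "continuous_on C g" using g CX(2) continuous_on_subset by (auto simp: continuous_selections_def)
    show "\<exists>i\<in>?I. g x = f i x" if "x \<in> C" for x using g CX(2) that by (auto simp: continuous_selections_def)
    fix i j assume ij: "i \<in> ?I" "j \<in> ?I"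
    have "C \<subseteq> less i j \<or> C \<inter> less i j = {}" if "i \<in> ?I" "j \<in> ?I" for i j
      using that by (intro \<C>(4)[unfolded \<S>_def] CX(1) insertI2 image_eqI[of _ _ "(i, j)"]) auto
    then have dich: "(\<forall>x\<in>C. f i x < f j x) \<or> (\<forall>x\<in>C. \<not> f i x < f j x)" if "i \<in> ?I" "j \<in> ?I" for i j
      using that CX(2) unfolding less_def by blast
    show "(\<forall>x\<in>C. f i x = f j x) \<or> (\<forall>x\<in>C. f i x \<noteq> f j x)"
      using dich[OF ij] dich[OF ij(2,1)] by force
  qed simp
  \<comment> \<open>Several indices may fit, as some of the \<open>f i\<close> may coincide on
    \<open>C\<close>; any choice will do.\<close>
  define idx where "idx g C = (SOME i. i \<in> ?I \<and> (\<forall>x\<in>C. g x = f i x))" for g C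
  have idx: "idx g C \<in> ?I" "\<And>x. x \<in> C \<Longrightarrow> g x = f (idx g C) x"
    if "g \<in> continuous_selections r f X" "C \<in> \<D>" for g C
  proof -
    have "idx g C \<in> ?I \<and> (\<forall>x\<in>C. g x = f (idx g C) x)"
      unfolding idx_def by (rule someI_ex) (use sel[OF that] in blast)
    then show "idx g C \<in> ?I" "\<And>x. x \<in> C \<Longrightarrow> g x = f (idx g C) x" by auto
  qed
  \<comment> \<open>The chosen indices determine \<open>g\<close> on every cell inside
    \<open>X\<close>, and these cells cover \<open>X\<close>; off \<open>X\<close> both functions
    are fixed by extensionality.\<close>
  have "inj_on (\<lambda>g. restrict (idx g) \<D>) (continuous_selections r f X)"
  proof (rule inj_onI)
    fix g h assume gh: "g \<in> continuous_selections r f X" "h \<in> continuous_selections r f X"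
      "restrict (idx g) \<D> = restrict (idx h) \<D>"
    show "g = h"
    proof (rule extensionalityI[of _ X])
      show "g \<in> extensional X" "h \<in> extensional X" using gh by (auto simp: continuous_selections_def)
      fix x assume "x \<in> X"
      then obtain C where C: "C \<in> \<D>" "x \<in> C" using X by blast
      then have "idx g C = idx h C" using gh(3) by (metis restrict_apply')
      then show "g x = h x" using idx(2)[OF gh(1) C] idx(2)[OF gh(2) C] by simp
    qed
  qed
  moreover have "(\<lambda>g. restrict (idx g) \<D>) ` continuous_selections r f X \<subseteq> \<D> \<rightarrow>\<^sub>E ?I"
    using idx(1) by auto
  moreover have "finite (\<D> \<rightarrow>\<^sub>E ?I)" using fin\<D> by (intro finite_PiE) auto
  ultimately have "finite (continuous_selections r f X)" by (rule inj_on_finite)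
  moreover have "semialgebraic_fun_on X g" if g: "g \<in> continuous_selections r f X" for g
  proof -
    have "(\<lambda>x. (x, g x)) ` X = (\<Union>C\<in>\<D>. (\<lambda>x. (x, f (idx g C) x)) ` X \<inter> fst -` C)"
    proof (intro equalityI subsetI)
      fix z assume "z \<in> (\<lambda>x. (x, g x)) ` X"
      then obtain x where x: "x \<in> X" "z = (x, g x)" by blast
      then obtain C where C: "C \<in> \<D>" "x \<in> C" using X by blast
      then show "z \<in> (\<Union>C\<in>\<D>. (\<lambda>x. (x, f (idx g C) x)) ` X \<inter> fst -` C)"
        using x idx(2)[OF g C] by auto
    next
      fix z assume "z \<in> (\<Union>C\<in>\<D>. (\<lambda>x. (x, f (idx g C) x)) ` X \<inter> fst -` C)"
      then obtain C x where C: "C \<in> \<D>" "x \<in> C" "x \<in> X" "z = (x, f (idx g C) x)" by auto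
      then show "z \<in> (\<lambda>x. (x, g x)) ` X" using idx(2)[OF g C(1,2)] by auto
    qed
    moreover have "semialgebraic \<dots>"
    proof (intro semialgebraic_UN semialgebraic_Int semialgebraic_vimage fin\<D>)
      fix C assume C: "C \<in> \<D>"
      show "semialgebraic ((\<lambda>x. (x, f (idx g C) x)) ` X)"
        using assms(3)[OF idx(1)[OF g C]] by (simp add: semialgebraic_fun_on_def)
      show "semialgebraic C" using C \<C>(3) by (simp add: \<D>_def)
      show "polynomial_function (fst :: (real ^ 'n) \<times> real \<Rightarrow> real ^ 'n)"
        by (intro polynomial_function_bounded_linear bounded_linear_fst)
    qed
    ultimately show ?thesis by (simp add: semialgebraic_fun_on_def)
  qed
  ultimately show ?thesis by blast
qed

end
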